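(* Let $\mathcal{D}=B_{n_1}\times\cdots\times B_{n_k}$, let $b:\mathcal{D}\to\mathbb{D}$ be a non-constant holomorphic function, and for $\alpha\in\mathbb{T}$ let $\sigma_\alpha=\sigma_\alpha[b]$ be the corresponding Clark measure on $\partial\mathcal{D}$. For each $\alpha\in\mathbb{T}$, the formula $$ (V_{b,\alpha}g)(z)=(1-\overline{\alpha}b(z))\,(g\sigma_\alpha)_+(z),\qquad g\in L^2(\sigma_\alpha),\ z\in\mathcal{D}, $$ defines a partial isometry from $L^2(\sigma_\alpha)$ into $\mathcal{H}(b)$. The restriction of $V_{b,\alpha}$ to $H^2(\sigma_\alpha)$ coincides with $U_{b,\alpha}^*$, where $U_{b,\alpha}:\mathcal{H}(b)\to H^2(\sigma_\alpha)$ is the unitary operator determined by $U_{b,\alpha}k_b(\cdot,w)=(1-\alpha\overline{b(w)})C(\cdot,w)$, $w\in\mathcal{D}$; in particular, $$ \bigl(V_{b,\alpha}C(\cdot,w)\bigr)(z)=(1-\alpha\overline{b(w)})^{-1}k_b(z,w),\qquad z,w\in\mathcal{D}, $$ where $k_b(z,w)$ denotes the reproducing kernel of $\mathcal{H}(b)$.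
   Context: $B_n$ is the open unit ball of $\mathbb{C}^n$, $\mathbb{D}=B_1$, $\mathbb{T}=\partial B_1$. Here $k\in\mathbb{N}$, $n_1,\dots,n_k\in\mathbb{N}$, $\mathcal{D}=B_{n_1}\times\cdots\times B_{n_k}\subset\mathbb{C}^{n_1+\cdots+n_k}$, and $\partial\mathcal{D}$ denotes the distinguished boundary $\partial B_{n_1}\times\cdots\times\partial B_{n_k}$, with $\Sigma$ the normalized Lebesgue measure on it. Points are written $z=(z_1,\dots,z_k)$ with $z_j\in\overline{B_{n_j}}$. Cauchy kernel: $C(z,\zeta)=\prod_{j=1}^k(1-\langle z_j,\zeta_j\rangle)^{-n_j}$, where $\langle\cdot,\cdot\rangle$ is the standard Hermitian product, linear in the first variable (used when at least one of $z,\zeta$ lies in $\mathcal{D}$ and the other in $\mathcal{D}\cup\partial\mathcal{D}$). Cauchy transform of a complex Borel measure $\mu$ on $\partial\mathcal{D}$: $\mu_+(z)=\int_{\partial\mathcal{D}}C(z,\zeta)\,d\mu(\zeta)$, $z\in\mathcal{D}$. Poisson kernel: $P(z,\zeta)=\frac{C(z,\zeta)C(\zeta,z)}{C(z,z)}$ for $z\in\mathcal{D}$, $\zeta\in\partial\mathcal{D}$; $P[\mu](z)=\int_{\partial\mathcal{D}}P(z,\zeta)\,d\mu(\zeta)$. Clark measure: for holomorphic $b:\mathcal{D}\to\mathbb{D}$ and $\alpha\in\mathbb{T}$, $\sigma_\alpha[b]$ is the unique positive Borel measure on $\partial\mathcal{D}$ such that $P[\sigma_\alpha[b]](z)=\frac{1-|b(z)|^2}{|\alpha-b(z)|^2}=\mathrm{Re}\left(\frac{\alpha+b(z)}{\alpha-b(z)}\right)$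 for all $z\in\mathcal{D}$. De Branges--Rovnyak space: for non-constant holomorphic $b:\mathcal{D}\to\mathbb{D}$, $\mathcal{H}(b)\subset H^2(\mathcal{D})$ is the Hilbert space of holomorphic functions on $\mathcal{D}$ with reproducing kernel $k_b(z,w)=(1-b(z)\overline{b(w)})C(z,w)$, where $H^2(\mathcal{D})$ is the Hardy space of holomorphic $f$ with $\sup_{0<r<1}\int_{\partial\mathcal{D}}|f(r\zeta)|^2\,d\Sigma(\zeta)<\infty$. $H^2(\sigma_\alpha)$ denotes the closed linear span in $L^2(\sigma_\alpha)$ of the holomorphic polynomials or, equivalently, of the functions $C(\cdot,w)$, $w\in\mathcal{D}$ (restricted to $\partial\mathcal{D}$). The assignment $k_b(\cdot,w)\mapsto(1-\alpha\overline{b(w)})C(\cdot,w)$, $w\in\mathcal{D}$, extends uniquely to a unitary operator $U_{b,\alpha}$ from $\mathcal{H}(b)$ onto $H^2(\sigma_\alpha)$. *)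

theory Defs
  imports "HOL-Analysis.Analysis"
begin

section \<open>Products of balls\<close>

text \<open>
  The coordinates of \<open>\<complex>\<close>-space of dimension \<open>n\<^sub>1 + \<dots> + n\<^sub>k\<close> are indexed by a finite
  type \<open>'n\<close>, the factors by a finite type \<open>'k\<close>, and \<open>blk i\<close> is the factor that the coordinate \<open>i\<close>
  belongs to.  Thus \<open>n\<^sub>j = card (blk -` {j})\<close>, and \<open>surj blk\<close> says that every \<open>n\<^sub>j\<close> is at least 1.
  The block \<open>z\<^sub>j\<close> of a point \<open>z\<close> is the family of the \<open>z $ i\<close> with \<open>blk i = j\<close>.
\<close>

definition block_norm :: "('n::finite \<Rightarrow> 'k::finite) \<Rightarrow> 'k \<Rightarrow> complex ^ 'n \<Rightarrow> real" where
  "block_norm blk j z = L2_set (\<lambda>i. norm (z $ i)) (blk -` {j})"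

definition block_inner ::
    "('n::finite \<Rightarrow> 'k::finite) \<Rightarrow> 'k \<Rightarrow> complex ^ 'n \<Rightarrow> complex ^ 'n \<Rightarrow> complex" where
  "block_inner blk j z w = (\<Sum>i \<in> blk -` {j}. z $ i * cnj (w $ i))"

definition ball_product :: "('n::finite \<Rightarrow> 'k::finite) \<Rightarrow> (complex ^ 'n) set" where
  "ball_product blk = {z. \<forall>j. block_norm blk j z < 1}"

definition dist_boundary :: "('n::finite \<Rightarrow> 'k::finite) \<Rightarrow> (complex ^ 'n) set" where
  "dist_boundary blk = {z. \<forall>j. block_norm blk j z = 1}"

text \<open>
  Holomorphy in several variables on an open set: complex differentiability, that is, real
  (Frechet) differentiability with a complex-linear derivative.
\<close>

definition holomorphic_sv :: "(complex ^ 'n::finite \<Rightarrow> complex) \<Rightarrow> (complex ^ 'n) set \<Rightarrow> bool" where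
  "holomorphic_sv f S \<longleftrightarrow>
     (\<forall>z\<in>S. \<exists>f'. (f has_derivative f') (at z) \<and> (\<forall>c v. f' (c *s v) = c * f' v))"

definition holomorphic_polynomials :: "(complex ^ 'n::finite \<Rightarrow> complex) set" where
  "holomorphic_polynomials =
     {\<lambda>z. \<Sum>\<beta>\<in>B. c \<beta> * (\<Prod>i\<in>UNIV. z $ i ^ \<beta> i) | (B :: ('n \<Rightarrow> nat) set) c. finite B}"

definition cauchy_kernel ::
    "('n::finite \<Rightarrow> 'k::finite) \<Rightarrow> complex ^ 'n \<Rightarrow> complex ^ 'n \<Rightarrow> complex" where
  "cauchy_kernel blk z w =
     (\<Prod>j\<in>UNIV. 1 / (1 - block_inner blk j z w) ^ card (blk -` {j}))"

definition poisson_kernel ::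
    "('n::finite \<Rightarrow> 'k::finite) \<Rightarrow> complex ^ 'n \<Rightarrow> complex ^ 'n \<Rightarrow> complex" where
  "poisson_kernel blk z w =
     cauchy_kernel blk z w * cauchy_kernel blk w z / cauchy_kernel blk z z"

text \<open>The Cauchy transform of the complex measure \<open>g \<sigma>\<close>.\<close>

definition cauchy_transform ::
    "('n::finite \<Rightarrow> 'k::finite) \<Rightarrow> (complex ^ 'n) measure \<Rightarrow> (complex ^ 'n \<Rightarrow> complex) \<Rightarrow>
     complex ^ 'n \<Rightarrow> complex" where
  "cauchy_transform blk \<sigma> g z = (\<integral>\<zeta>. cauchy_kernel blk z \<zeta> * g \<zeta> \<partial>\<sigma>)"

text \<open>
  Finiteness is part of being a Clark measure only because the Bochner integral of a
  non-integrable function is 0 in HOL; the Poisson kernel is bounded below on the boundary.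
\<close>

definition clark_measure ::
    "('n::finite \<Rightarrow> 'k::finite) \<Rightarrow> (complex ^ 'n \<Rightarrow> complex) \<Rightarrow> complex \<Rightarrow>
     (complex ^ 'n) measure \<Rightarrow> bool" where
  "clark_measure blk b \<alpha> \<sigma> \<longleftrightarrow>
     sets \<sigma> = sets (restrict_space borel (dist_boundary blk)) \<and> finite_measure \<sigma> \<and>
     (\<forall>z\<in>ball_product blk.
        (\<integral>\<zeta>. poisson_kernel blk z \<zeta> \<partial>\<sigma>) =
        of_real ((1 - (norm (b z))\<^sup>2) / (norm (\<alpha> - b z))\<^sup>2))"


section \<open>Spaces of complex functions with a semi-inner product\<close>

text \<open>
  A space is given by a set \<open>A\<close> of functions, with the pointwise operations, and a semi-inner
  product \<open>ip\<close>, linear in the first argument.  Elements at seminorm distance 0 are identified; for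
  the \<open>L\<^sup>2\<close> space below, whose elements are represented by functions, this is equality almost
  everywhere.
\<close>

type_synonym 'x semi_inner = "('x \<Rightarrow> complex) \<Rightarrow> ('x \<Rightarrow> complex) \<Rightarrow> complex"

definition ip_norm :: "'x semi_inner \<Rightarrow> ('x \<Rightarrow> complex) \<Rightarrow> real" where
  "ip_norm ip f = sqrt (Re (ip f f))"

definition ip_dist :: "'x semi_inner \<Rightarrow> ('x \<Rightarrow> complex) \<Rightarrow> ('x \<Rightarrow> complex) \<Rightarrow> real" where
  "ip_dist ip f g = ip_norm ip (\<lambda>x. f x - g x)"

definition linear_map ::
    "('x \<Rightarrow> complex) set \<Rightarrow> ('y \<Rightarrow> complex) set \<Rightarrow> 'y semi_inner \<Rightarrow>
     (('x \<Rightarrow> complex) \<Rightarrow> ('y \<Rightarrow> complex)) \<Rightarrow> bool" where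
  "linear_map A B ipB T \<longleftrightarrow>
     (\<forall>f\<in>A. T f \<in> B) \<and>
     (\<forall>f\<in>A. \<forall>g\<in>A. \<forall>c. ip_dist ipB (T (\<lambda>x. c * f x + g x)) (\<lambda>y. c * T f y + T g y) = 0)"

text \<open>
  A bounded linear operator that is isometric on the orthogonal complement of its kernel.  This
  also forces \<open>T\<close> to respect the identification of elements at distance 0.
\<close>

definition partial_isometry ::
    "('x \<Rightarrow> complex) set \<Rightarrow> 'x semi_inner \<Rightarrow> ('y \<Rightarrow> complex) set \<Rightarrow> 'y semi_inner \<Rightarrow>
     (('x \<Rightarrow> complex) \<Rightarrow> ('y \<Rightarrow> complex)) \<Rightarrow> bool" where
  "partial_isometry A ipA B ipB T \<longleftrightarrow>
     linear_map A B ipB T \<and>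
     (\<exists>K. \<forall>f\<in>A. ip_norm ipB (T f) \<le> K * ip_norm ipA f) \<and>
     (\<forall>f\<in>A. (\<forall>g\<in>A. ip_norm ipB (T g) = 0 \<longrightarrow> ipA f g = 0) \<longrightarrow>
        ip_norm ipB (T f) = ip_norm ipA f)"

definition unitary_map ::
    "('x \<Rightarrow> complex) set \<Rightarrow> 'x semi_inner \<Rightarrow> ('y \<Rightarrow> complex) set \<Rightarrow> 'y semi_inner \<Rightarrow>
     (('x \<Rightarrow> complex) \<Rightarrow> ('y \<Rightarrow> complex)) \<Rightarrow> bool" where
  "unitary_map A ipA B ipB T \<longleftrightarrow>
     linear_map A B ipB T \<and>
     (\<forall>f\<in>A. \<forall>g\<in>A. ipB (T f) (T g) = ipA f g) \<and>
     (\<forall>h\<in>B. \<exists>f\<in>A. ip_dist ipB (T f) h = 0)"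

definition is_adjoint ::
    "('x \<Rightarrow> complex) set \<Rightarrow> 'x semi_inner \<Rightarrow> ('y \<Rightarrow> complex) set \<Rightarrow> 'y semi_inner \<Rightarrow>
     (('x \<Rightarrow> complex) \<Rightarrow> ('y \<Rightarrow> complex)) \<Rightarrow> (('y \<Rightarrow> complex) \<Rightarrow> ('x \<Rightarrow> complex)) \<Rightarrow> bool" where
  "is_adjoint A ipA B ipB T S \<longleftrightarrow>
     (\<forall>g\<in>B. S g \<in> A) \<and> (\<forall>f\<in>A. \<forall>g\<in>B. ipB (T f) g = ipA f (S g))"

definition L2_space :: "'x measure \<Rightarrow> ('x \<Rightarrow> complex) set" where
  "L2_space M = {f \<in> borel_measurable M. integrable M (\<lambda>x. (norm (f x))\<^sup>2)}"

definition L2_inner :: "'x measure \<Rightarrow> 'x semi_inner" where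
  "L2_inner M f g = (\<integral>x. f x * cnj (g x) \<partial>M)"

text \<open>The polynomials form a linear space, so their closed linear span is their closure.\<close>

definition H2_space :: "(complex ^ 'n::finite) measure \<Rightarrow> (complex ^ 'n \<Rightarrow> complex) set" where
  "H2_space \<sigma> =
     {f \<in> L2_space \<sigma>. \<forall>e>0. \<exists>p\<in>holomorphic_polynomials. ip_dist (L2_inner \<sigma>) f p < e}"


section \<open>Reproducing kernel Hilbert spaces and de Branges--Rovnyak spaces\<close>

text \<open>
  A function on a set \<open>X\<close> is represented by its extension by 0, so that equality of functions on
  \<open>X\<close> is equality in HOL and the pointwise operations need no restriction.
\<close>

definition on_set :: "'x set \<Rightarrow> ('x \<Rightarrow> complex) \<Rightarrow> ('x \<Rightarrow> complex)" where
  "on_set X f = (\<lambda>x. if x \<in> X then f x else 0)"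

locale hilbert_function_space =
  fixes X :: "'x set" and H :: "('x \<Rightarrow> complex) set" and ip :: "'x semi_inner"
  assumes functions_on: "f \<in> H \<Longrightarrow> on_set X f = f"
    and zero_mem: "(\<lambda>x. 0) \<in> H"
    and lincomb_mem: "f \<in> H \<Longrightarrow> g \<in> H \<Longrightarrow> (\<lambda>x. c * f x + g x) \<in> H"
    and ip_linear:
      "f \<in> H \<Longrightarrow> g \<in> H \<Longrightarrow> h \<in> H \<Longrightarrow> ip (\<lambda>x. c * f x + g x) h = c * ip f h + ip g h"
    and ip_hermitian: "f \<in> H \<Longrightarrow> g \<in> H \<Longrightarrow> ip g f = cnj (ip f g)"
    and ip_pos: "f \<in> H \<Longrightarrow> f \<noteq> (\<lambda>x. 0) \<Longrightarrow> Re (ip f f) > 0"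
    and complete:
      "(\<And>m. F m \<in> H) \<Longrightarrow>
       (\<And>e. e > 0 \<Longrightarrow> \<exists>N. \<forall>m\<ge>N. \<forall>n\<ge>N. ip_dist ip (F m) (F n) < e) \<Longrightarrow>
       \<exists>f\<in>H. (\<lambda>n::nat. ip_dist ip (F n) f) \<longlonglongrightarrow> 0"

locale reproducing_kernel_space = hilbert_function_space X H ip
  for X :: "'x set" and H :: "('x \<Rightarrow> complex) set" and ip :: "'x semi_inner" +
  fixes K :: "'x \<Rightarrow> 'x \<Rightarrow> complex"
  assumes kernel_mem: "w \<in> X \<Longrightarrow> on_set X (\<lambda>z. K z w) \<in> H"
    and reproducing: "f \<in> H \<Longrightarrow> w \<in> X \<Longrightarrow> ip f (on_set X (\<lambda>z. K z w)) = f w"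

text \<open>
  The normalized Lebesgue (surface) measure on the distinguished boundary, by polar coordinates in
  each factor: the image of the normalized volume measure under \<open>z\<^sub>j \<mapsto> z\<^sub>j / |z\<^sub>j|\<close>, as a Borel
  measure on the whole space that is concentrated on the distinguished boundary.
\<close>

definition boundary_measure :: "('n::finite \<Rightarrow> 'k::finite) \<Rightarrow> (complex ^ 'n) measure" where
  "boundary_measure blk =
     distr (uniform_measure lborel (ball_product blk)) borel
       (\<lambda>z. \<chi> i. z $ i / of_real (block_norm blk (blk i) z))"

definition hardy_space :: "('n::finite \<Rightarrow> 'k::finite) \<Rightarrow> (complex ^ 'n \<Rightarrow> complex) set" where
  "hardy_space blk =
     {f. on_set (ball_product blk) f = f \<and> holomorphic_sv f (ball_product blk) \<and>
         (SUP r\<in>{0<..<1}. \<integral>\<^sup>+\<zeta>. ennreal ((norm (f (r *\<^sub>R \<zeta>)))\<^sup>2) \<partial>boundary_measure blk) < \<infinity>}"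

definition dbr_kernel ::
    "('n::finite \<Rightarrow> 'k::finite) \<Rightarrow> (complex ^ 'n \<Rightarrow> complex) \<Rightarrow>
     complex ^ 'n \<Rightarrow> complex ^ 'n \<Rightarrow> complex" where
  "dbr_kernel blk b z w = (1 - b z * cnj (b w)) * cauchy_kernel blk z w"

definition de_branges_rovnyak ::
    "('n::finite \<Rightarrow> 'k::finite) \<Rightarrow> (complex ^ 'n \<Rightarrow> complex) \<Rightarrow>
     (complex ^ 'n \<Rightarrow> complex) set \<Rightarrow> (complex ^ 'n) semi_inner \<Rightarrow> bool" where
  "de_branges_rovnyak blk b H ip \<longleftrightarrow>
     H \<subseteq> hardy_space blk \<and>
     reproducing_kernel_space (ball_product blk) H ip (dbr_kernel blk b)"


section \<open>The operators\<close>

definition V_op ::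
    "('n::finite \<Rightarrow> 'k::finite) \<Rightarrow> (complex ^ 'n \<Rightarrow> complex) \<Rightarrow> complex \<Rightarrow>
     (complex ^ 'n) measure \<Rightarrow> (complex ^ 'n \<Rightarrow> complex) \<Rightarrow> (complex ^ 'n \<Rightarrow> complex)" where
  "V_op blk b \<alpha> \<sigma> g =
     on_set (ball_product blk) (\<lambda>z. (1 - cnj \<alpha> * b z) * cauchy_transform blk \<sigma> g z)"

definition is_clark_unitary ::
    "('n::finite \<Rightarrow> 'k::finite) \<Rightarrow> (complex ^ 'n \<Rightarrow> complex) \<Rightarrow> complex \<Rightarrow>
     (complex ^ 'n) measure \<Rightarrow> (complex ^ 'n \<Rightarrow> complex) set \<Rightarrow> (complex ^ 'n) semi_inner \<Rightarrow>
     ((complex ^ 'n \<Rightarrow> complex) \<Rightarrow> (complex ^ 'n \<Rightarrow> complex)) \<Rightarrow> bool" where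
  "is_clark_unitary blk b \<alpha> \<sigma> H ip U \<longleftrightarrow>
     unitary_map H ip (H2_space \<sigma>) (L2_inner \<sigma>) U \<and>
     (\<forall>w\<in>ball_product blk. AE \<zeta> in \<sigma>.
        U (on_set (ball_product blk) (\<lambda>z. dbr_kernel blk b z w)) \<zeta> =
        (1 - \<alpha> * cnj (b w)) * cauchy_kernel blk \<zeta> w)"

end

theory Submission
  imports Defs "HOL-Complex_Analysis.Conformal_Mappings"
begin

text \<open>
  Put \<open>e\<^sub>w = (1 - \<alpha> cnj (b w)) C(\<cdot>, w)\<close>, so that \<open>(V g)(z) = \<langle>g, e\<^sub>z\<rangle>\<close> in \<open>L\<^sup>2(\<sigma>)\<close>.  The defining property of
  the Clark measure says that \<open>\<langle>e\<^sub>z, e\<^sub>z\<rangle> = k\<^sub>b(z, z)\<close>; since both sides of \<open>\<langle>e\<^sub>w, e\<^sub>z\<rangle> = k\<^sub>b(z, w)\<close> are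
  holomorphic in \<open>z\<close> and antiholomorphic in \<open>w\<close>, the latter identity follows.  Thus \<open>e\<close> is a feature
  map for the kernel of \<open>H(b)\<close>, and \<open>V\<close> is isometric on the closed span of the \<open>e\<^sub>w\<close>, zero on its
  orthogonal complement, and has dense and closed range in \<open>H(b)\<close>.  The closed span is \<open>H\<^sup>2(\<sigma>)\<close>:
  \<open>C(\<cdot>, w)\<close> is a uniform limit of polynomials on the boundary, and the monomials are multiples of
  derivatives of \<open>C(\<cdot>, w)\<close> with respect to the conjugate of \<open>w\<close> at \<open>w = 0\<close>.
\<close>

section \<open>Semi-inner product spaces of functions\<close>

text \<open>Two obstacles shape the argument. The space \<open>H\<close> is known only through its
  axioms, with no formula for its norm, so \<open>V g \<in> H\<close> cannot be read off from a
  growth condition. It has to come out of completeness: \<open>V\<close> is followed on a closed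
  subspace on which it is isometric into \<open>H\<close>, and the projection onto that subspace has
  the same image under \<open>V\<close> as the original vector. Moreover, elements of
  \<open>L\<^sup>2\<close> are functions and not classes, so a vector of norm 0 need not be the zero
  function. The Hilbert space tools are therefore developed for a semi-inner product, where a
  projection is determined only up to distance 0, and the unitary operator arises by choosing a
  preimage under \<open>V\<close>.\<close>

locale semi_inner_space =
  fixes A :: "('x \<Rightarrow> complex) set" and ip :: "'x semi_inner"
  assumes zero_mem: "(\<lambda>x. 0) \<in> A"
    and lincomb_mem: "f \<in> A \<Longrightarrow> g \<in> A \<Longrightarrow> (\<lambda>x. c * f x + g x) \<in> A"
    and ip_linear:
      "f \<in> A \<Longrightarrow> g \<in> A \<Longrightarrow> h \<in> A \<Longrightarrow> ip (\<lambda>x. c * f x + g x) h = c * ip f h + ip g h"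
    and ip_hermitian: "f \<in> A \<Longrightarrow> g \<in> A \<Longrightarrow> ip g f = cnj (ip f g)"
    and ip_nonneg: "f \<in> A \<Longrightarrow> Re (ip f f) \<ge> 0"

definition lin_subspace :: "('x \<Rightarrow> complex) set \<Rightarrow> bool" where
  "lin_subspace M \<longleftrightarrow> (\<lambda>x. 0) \<in> M \<and> (\<forall>f\<in>M. \<forall>g\<in>M. \<forall>c. (\<lambda>x. c * f x + g x) \<in> M)"

definition ip_cauchy :: "'x semi_inner \<Rightarrow> (nat \<Rightarrow> 'x \<Rightarrow> complex) \<Rightarrow> bool" where
  "ip_cauchy ip F \<longleftrightarrow> (\<forall>e>0. \<exists>N. \<forall>m\<ge>N. \<forall>n\<ge>N. ip_dist ip (F m) (F n) < e)"

definition ip_complete :: "'x semi_inner \<Rightarrow> ('x \<Rightarrow> complex) set \<Rightarrow> bool" where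
  "ip_complete ip M \<longleftrightarrow>
     (\<forall>F. (\<forall>n. F n \<in> M) \<longrightarrow> ip_cauchy ip F \<longrightarrow> (\<exists>f\<in>M. (\<lambda>n. ip_dist ip (F n) f) \<longlonglongrightarrow> 0))"

lemma lin_subspace_lincomb:
  assumes "lin_subspace M" "f \<in> M" "g \<in> M"
  shows "(\<lambda>x. c * f x + g x) \<in> M"
  using assms by (simp add: lin_subspace_def)

lemma lin_subspace_zero: "lin_subspace M \<Longrightarrow> (\<lambda>x. 0) \<in> M"
  by (simp add: lin_subspace_def)

lemma lin_subspace_diff:
  assumes "lin_subspace M" "f \<in> M" "g \<in> M"
  shows "(\<lambda>x. f x - g x) \<in> M"
  using lin_subspace_lincomb[OF assms(1,3,2), of "-1"] by simp

lemma lin_subspace_scale: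
  assumes "lin_subspace M" "f \<in> M"
  shows "(\<lambda>x. c * f x) \<in> M"
  using lin_subspace_lincomb[OF assms lin_subspace_zero[OF assms(1)], of c] by simp

text \<open>For small positive \<open>t\<close> the linear term outweighs the quadratic one unless
  \<open>s\<close> vanishes. This is the variational step of the projection theorem.\<close>

lemma quadratic_nonneg_imp_zero:
  fixes s a :: real
  assumes "\<And>t. 0 \<le> t\<^sup>2 * (s * a) - 2 * t * s" "a \<ge> 0" "s \<ge> 0"
  shows "s = 0"
proof (rule ccontr)
  assume "s \<noteq> 0"
  \<comment> \<open>The summand 1 keeps the denominator positive when \<open>a = 0\<close>; what
    matters is \<open>u > 0\<close> and \<open>u * a < 2\<close>.\<close>
  define u where "u = 1 / (a + 1)"
  have u: "u > 0" "u * a < 1" using assms(2) by (auto simp: u_def field_simps)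
  have "0 \<le> (u * s) * (u * a - 2)"
    using assms(1)[of u] by (simp add: power2_eq_square algebra_simps)
  moreover have "(u * s) * (u * a - 2) < 0"
    using u \<open>s \<noteq> 0\<close> assms(3) by (intro mult_pos_neg) auto
  ultimately show False by simp
qed

lemma Re_scaled_cnj_mult: "Re (of_real t * cnj s * s) = t * (norm s)\<^sup>2"
proof -
  have "of_real t * cnj s * s = of_real (t * (norm s)\<^sup>2)"
    by (simp only: of_real_mult complex_norm_square mult_ac)
  then show ?thesis by (simp only: Re_complex_of_real)
qed

section \<open>Cauchy-Schwarz, convergence and projection for a semi-inner product\<close>

context semi_inner_space
begin

lemma lin_subspace_carrier: "lin_subspace A"
  by (simp add: lin_subspace_def zero_mem lincomb_mem)

lemmas diff_mem = lin_subspace_diff[OF lin_subspace_carrier]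
lemmas scale_mem = lin_subspace_scale[OF lin_subspace_carrier]

lemma ip_zero_left: "h \<in> A \<Longrightarrow> ip (\<lambda>x. 0) h = 0"
  using ip_linear[of "\<lambda>x. 0" "\<lambda>x. 0" h 1] by (simp add: zero_mem)

lemma ip_scale_left:
  assumes "f \<in> A" "h \<in> A" shows "ip (\<lambda>x. c * f x) h = c * ip f h"
  using ip_linear[of f "\<lambda>x. 0" h c] assms by (simp add: zero_mem ip_zero_left)

lemma ip_diff_left:
  assumes "f \<in> A" "g \<in> A" "h \<in> A" shows "ip (\<lambda>x. f x - g x) h = ip f h - ip g h"
  using ip_linear[of g f h "-1"] assms by simp

lemma ip_linear_right:
  assumes "f \<in> A" "g \<in> A" "h \<in> A"
  shows "ip h (\<lambda>x. c * f x + g x) = cnj c * ip h f + ip h g"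
  using assms by (simp add: ip_hermitian[of _ h] lincomb_mem ip_linear)

lemma ip_scale_right:
  assumes "f \<in> A" "h \<in> A" shows "ip h (\<lambda>x. c * f x) = cnj c * ip h f"
  using assms by (simp add: ip_hermitian[of _ h] scale_mem ip_scale_left)

lemma ip_diff_right:
  assumes "f \<in> A" "g \<in> A" "h \<in> A" shows "ip h (\<lambda>x. f x - g x) = ip h f - ip h g"
  using assms by (simp add: ip_hermitian[of _ h] diff_mem ip_diff_left)

lemma ip_zero_right: "h \<in> A \<Longrightarrow> ip h (\<lambda>x. 0) = 0"
  using ip_hermitian[of "\<lambda>x. 0" h] by (simp add: zero_mem ip_zero_left)

lemma ip_norm_nonneg: "f \<in> A \<Longrightarrow> ip_norm ip f \<ge> 0"
  by (simp add: ip_norm_def ip_nonneg)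

lemma ip_norm_power2: "f \<in> A \<Longrightarrow> (ip_norm ip f)\<^sup>2 = Re (ip f f)"
  by (simp add: ip_norm_def ip_nonneg)

lemma ip_self: "f \<in> A \<Longrightarrow> ip f f = of_real ((ip_norm ip f)\<^sup>2)"
  using ip_hermitian[of f f] by (simp add: ip_norm_power2 complex_eq_iff)

text \<open>This one expansion yields Cauchy-Schwarz, the triangle inequality, the parallelogram law
  and Pythagoras, each by a suitable choice of \<open>c\<close>.\<close>

lemma ip_norm_lincomb_power2:
  assumes "f \<in> A" "g \<in> A"
  shows "(ip_norm ip (\<lambda>x. c * f x + g x))\<^sup>2 =
    (norm c)\<^sup>2 * (ip_norm ip f)\<^sup>2 + 2 * Re (c * ip f g) + (ip_norm ip g)\<^sup>2"
proof -
  have "ip (\<lambda>x. c * f x + g x) (\<lambda>x. c * f x + g x)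
      = c * (cnj c * ip f f + ip f g) + (cnj c * cnj (ip f g) + ip g g)"
    using assms by (simp add: ip_linear lincomb_mem ip_linear_right ip_hermitian[of f g])
  also have "\<dots> = (c * cnj c) * ip f f + (c * ip f g + cnj (c * ip f g)) + ip g g"
    by (simp add: algebra_simps)
  also have "\<dots> = of_real ((norm c)\<^sup>2 * (ip_norm ip f)\<^sup>2) + of_real (2 * Re (c * ip f g))
      + of_real ((ip_norm ip g)\<^sup>2)"
    using assms by (simp only: ip_self complex_norm_square complex_add_cnj of_real_mult)
  finally show ?thesis
    using assms by (simp add: ip_norm_power2 lincomb_mem del: of_real_mult of_real_power)
qed

lemma cauchy_schwarz:
  assumes "f \<in> A" "g \<in> A"
  shows "norm (ip f g) \<le> ip_norm ip f * ip_norm ip g"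
proof -
  define s where "s = (norm (ip f g))\<^sup>2"
  define a where "a = (ip_norm ip f)\<^sup>2"
  define d where "d = (ip_norm ip g)\<^sup>2"
  have *: "0 \<le> t\<^sup>2 * (s * a) - 2 * t * s + d" for t :: real
  proof -
    \<comment> \<open>The conjugate factor cancels the phase of \<open>ip f g\<close>, so the cross
      term becomes the real number \<open>- t * s\<close>.\<close>
    define c where "c = of_real (- t) * cnj (ip f g)"
    have "Re (c * ip f g) = - t * s"
      by (simp only: c_def s_def Re_scaled_cnj_mult)
    moreover have "(norm c)\<^sup>2 = t\<^sup>2 * s"
      by (simp add: c_def s_def norm_mult power_mult_distrib)
    ultimately show ?thesis
      using ip_norm_lincomb_power2[OF assms, of c]
        zero_le_power2[of "ip_norm ip (\<lambda>x. c * f x + g x)"]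
      by (simp add: a_def d_def mult.assoc)
  qed
  have "s \<le> a * d"
  proof (cases "a = 0")
    case True
    show ?thesis
    proof (cases "s = 0")
      case False
      \<comment> \<open>A null vector need not be the zero function, so this case is not vacuous.
        The expression in \<open>*\<close> is now affine in \<open>t\<close> with slope
        \<open>- 2 * s\<close>, and the chosen \<open>t\<close> gives it the value
        \<open>- d - 2\<close>, a contradiction.\<close>
      then show ?thesis
        using *[of "(d + 1) / s"] True zero_le_power2[of "ip_norm ip g"]
        by (simp add: d_def)
    qed (simp add: a_def d_def)
  next
    case False
    then have "a > 0" by (simp add: a_def)
    \<comment> \<open>\<open>t = 1 / a\<close> minimises the quadratic; its value there is
      \<open>d - s / a\<close>.\<close>
    then show ?thesis
      using *[of "1 / a"] mult_left_mono[of 0 "(1 / a)\<^sup>2 * (s * a) - 2 * (1 / a) * s + d" a]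
      by (simp add: power2_eq_square algebra_simps)
  qed
  then have "(norm (ip f g))\<^sup>2 \<le> (ip_norm ip f * ip_norm ip g)\<^sup>2"
    by (simp add: s_def a_def d_def power_mult_distrib)
  then show ?thesis
    by (rule power2_le_imp_le) (simp add: assms ip_norm_nonneg)
qed

lemma ip_norm_triangle:
  assumes "f \<in> A" "g \<in> A"
  shows "ip_norm ip (\<lambda>x. f x + g x) \<le> ip_norm ip f + ip_norm ip g"
proof (rule power2_le_imp_le)
  have "(ip_norm ip (\<lambda>x. f x + g x))\<^sup>2 = (ip_norm ip f)\<^sup>2 + 2 * Re (ip f g) + (ip_norm ip g)\<^sup>2"
    using ip_norm_lincomb_power2[OF assms, of 1] by simp
  also have "\<dots> \<le> (ip_norm ip f + ip_norm ip g)\<^sup>2"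
    using cauchy_schwarz[OF assms] complex_Re_le_cmod[of "ip f g"]
    by (simp add: power2_sum)
  finally show "(ip_norm ip (\<lambda>x. f x + g x))\<^sup>2 \<le> (ip_norm ip f + ip_norm ip g)\<^sup>2" .
qed (simp add: assms ip_norm_nonneg)

lemma ip_dist_triangle:
  assumes "f \<in> A" "g \<in> A" "h \<in> A"
  shows "ip_dist ip f h \<le> ip_dist ip f g + ip_dist ip g h"
  using ip_norm_triangle[OF diff_mem[OF assms(1,2)] diff_mem[OF assms(2,3)]]
  by (simp add: ip_dist_def)

lemma ip_dist_nonneg: "f \<in> A \<Longrightarrow> g \<in> A \<Longrightarrow> ip_dist ip f g \<ge> 0"
  by (simp add: ip_dist_def ip_norm_nonneg diff_mem)

lemma ip_norm_uminus: "f \<in> A \<Longrightarrow> ip_norm ip (\<lambda>x. - f x) = ip_norm ip f"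
  using ip_norm_lincomb_power2[of f "\<lambda>x. 0" "-1"] ip_norm_nonneg[of f]
    ip_norm_nonneg[OF scale_mem[of f "-1"]]
  by (auto simp: zero_mem ip_zero_right ip_norm_def)

lemma ip_dist_commute: "f \<in> A \<Longrightarrow> g \<in> A \<Longrightarrow> ip_dist ip f g = ip_dist ip g f"
  using ip_norm_uminus[OF diff_mem[of f g]] by (simp add: ip_dist_def)

lemma ip_dist_self: "ip_dist ip f f = 0"
  by (simp add: ip_dist_def ip_norm_def ip_zero_left zero_mem)

text \<open>By Cauchy-Schwarz a null vector is orthogonal to everything, so the form is well defined
  on classes of elements at distance 0.\<close>

lemma ip_eq_of_dist_zero:
  assumes "f \<in> A" "g \<in> A" "h \<in> A" "ip_dist ip f g = 0"
  shows "ip f h = ip g h"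
  using cauchy_schwarz[OF diff_mem[OF assms(1,2)] assms(3)] assms
  by (simp add: ip_dist_def ip_diff_left)

lemma ip_tendsto_left:
  assumes "\<And>n. F n \<in> A" "f \<in> A" "g \<in> A" "(\<lambda>n. ip_dist ip (F n) f) \<longlonglongrightarrow> 0"
  shows "(\<lambda>n. ip (F n) g) \<longlonglongrightarrow> ip f g"
proof (rule LIM_zero_cancel, rule Lim_null_comparison)
  show "\<forall>\<^sub>F n in sequentially. norm (ip (F n) g - ip f g) \<le> ip_dist ip (F n) f * ip_norm ip g"
    using cauchy_schwarz[OF diff_mem] assms(1-3)
    by (intro always_eventually allI) (simp add: ip_dist_def ip_diff_left flip: ip_diff_left)
  show "(\<lambda>n. ip_dist ip (F n) f * ip_norm ip g) \<longlonglongrightarrow> 0"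
    using tendsto_mult_left_zero[OF assms(4)] .
qed

lemma ip_tendsto_right:
  assumes "\<And>n. F n \<in> A" "f \<in> A" "g \<in> A" "(\<lambda>n. ip_dist ip (F n) f) \<longlonglongrightarrow> 0"
  shows "(\<lambda>n. ip g (F n)) \<longlonglongrightarrow> ip g f"
  using tendsto_cnj[OF ip_tendsto_left[OF assms]] assms(1-3)
  by (simp flip: ip_hermitian)

text \<open>The nearest-point argument: a minimising sequence is Cauchy by the parallelogram law,
  its limit in \<open>M\<close> attains the infimum, and the residual is orthogonal to
  \<open>M\<close> because no displacement within \<open>M\<close> can shorten it.\<close>

lemma orthogonal_projection:
  assumes M: "lin_subspace M" "M \<subseteq> A" "ip_complete ip M" and g: "g \<in> A"
  obtains p where "p \<in> M" "\<And>m. m \<in> M \<Longrightarrow> ip (\<lambda>x. g x - p x) m = 0"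
proof -
  define S where "S = (\<lambda>m. (ip_dist ip g m)\<^sup>2) ` M"
  define \<delta> where "\<delta> = Inf S"
  have bdd: "bdd_below S" unfolding S_def by (rule bdd_belowI2[of _ 0]) simp
  have M0: "(\<lambda>x. 0) \<in> M" using M(1) by (simp add: lin_subspace_def)
  have low: "\<delta> \<le> (ip_dist ip g m)\<^sup>2" if "m \<in> M" for m
    unfolding \<delta>_def using that by (intro cInf_lower bdd) (simp add: S_def)
  have "\<exists>m\<in>M. (ip_dist ip g m)\<^sup>2 < \<delta> + 1 / real (Suc n)" for n
  proof -
    have "Inf S < \<delta> + 1 / real (Suc n)" by (simp add: \<delta>_def)
    then show ?thesis
      using cInf_lessD[of S] M0 by (force simp: S_def)
  qed
  then obtain F where F: "\<And>n. F n \<in> M" "\<And>n. (ip_dist ip g (F n))\<^sup>2 < \<delta> + 1 / real (Suc n)"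
    by metis
  have FA: "F n \<in> A" for n using F(1) M(2) by blast
  \<comment> \<open>The midpoint of \<open>F m\<close> and \<open>F n\<close> lies in
    \<open>M\<close>, so its squared distance from \<open>g\<close> is at least
    \<open>\<delta>\<close>; the parallelogram law then leaves only the two excesses over
    \<open>\<delta>\<close>, doubled.\<close>
  have par: "(ip_dist ip (F m) (F n))\<^sup>2 \<le> 2 / real (Suc m) + 2 / real (Suc n)" for m n
  proof -
    let ?u = "\<lambda>x. g x - F m x" and ?v = "\<lambda>x. g x - F n x"
    let ?h = "\<lambda>x. (1/2) * F m x + (1/2) * F n x"
    have uv: "?u \<in> A" "?v \<in> A" using g FA by (auto intro: diff_mem)
    have h: "?h \<in> M"
      using lin_subspace_lincomb[OF M(1) F(1)[of m] lin_subspace_scale[OF M(1) F(1)[of n]]] .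
    have "\<delta> \<le> (ip_dist ip g ?h)\<^sup>2" by (rule low[OF h])
    also have "4 * (ip_dist ip g ?h)\<^sup>2 = (ip_norm ip (\<lambda>x. ?u x + ?v x))\<^sup>2"
    proof -
      have gh: "(\<lambda>x. g x - ?h x) \<in> A" using g h M(2) by (intro diff_mem) auto
      have "(\<lambda>x. ?u x + ?v x) = (\<lambda>x. 2 * (g x - ?h x) + 0)" by (auto simp: field_simps)
      then show ?thesis
        using ip_norm_lincomb_power2[OF gh zero_mem, of 2] gh
        by (simp add: ip_dist_def ip_zero_right zero_mem ip_norm_power2)
    qed
    finally have "4 * \<delta> \<le> (ip_norm ip (\<lambda>x. ?u x + ?v x))\<^sup>2" by simp
    moreover have "(ip_norm ip (\<lambda>x. ?u x + ?v x))\<^sup>2 + (ip_norm ip (\<lambda>x. - ?u x + ?v x))\<^sup>2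
        = 2 * (ip_norm ip ?u)\<^sup>2 + 2 * (ip_norm ip ?v)\<^sup>2"
      using ip_norm_lincomb_power2[OF uv, of 1] ip_norm_lincomb_power2[OF uv, of "-1"] by simp
    moreover have "(\<lambda>x. - ?u x + ?v x) = (\<lambda>x. F m x - F n x)" by auto
    ultimately show ?thesis
      using F(2)[of m] F(2)[of n] by (simp add: ip_dist_def)
  qed
  have "ip_cauchy ip F"
    unfolding ip_cauchy_def
  proof (intro allI impI)
    fix e :: real assume "e > 0"
    \<comment> \<open>With this \<open>N\<close> each of the two terms of \<open>par\<close> drops
      below \<open>e\<^sup>2 / 2\<close>.\<close>
    obtain N where N: "4 / e\<^sup>2 < real N" using reals_Archimedean2 by blast
    have "ip_dist ip (F m) (F n) < e" if "m \<ge> N" "n \<ge> N" for m n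
    proof (rule power2_less_imp_less)
      have b: "2 / real (Suc k) < e\<^sup>2 / 2" if "k \<ge> N" for k
      proof -
        have "4 / e\<^sup>2 < real (Suc k)" using N that by simp
        then show ?thesis using \<open>e > 0\<close> by (simp add: field_simps)
      qed
      show "(ip_dist ip (F m) (F n))\<^sup>2 < e\<^sup>2"
        using par[of m n] b[OF that(1)] b[OF that(2)] by linarith
    qed (use \<open>e > 0\<close> in simp)
    then show "\<exists>N. \<forall>m\<ge>N. \<forall>n\<ge>N. ip_dist ip (F m) (F n) < e" by blast
  qed
  then obtain p where p: "p \<in> M" "(\<lambda>n. ip_dist ip (F n) p) \<longlonglongrightarrow> 0"
    using M(3) F(1) unfolding ip_complete_def by blast
  have pA: "p \<in> A" using p(1) M(2) by blast
  have d0: "\<delta> \<ge> 0" unfolding \<delta>_def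
    by (rule cInf_greatest) (use M0 in \<open>auto simp: S_def\<close>)
  have "ip_dist ip g p \<le> sqrt \<delta>"
  proof (rule LIMSEQ_le_const)
    have "(\<lambda>n. sqrt (\<delta> + 1 / real (Suc n)) + ip_dist ip (F n) p) \<longlonglongrightarrow> sqrt (\<delta> + 0) + 0"
      using LIMSEQ_inverse_real_of_nat
      by (intro tendsto_intros p(2)) (simp add: inverse_eq_divide)
    then show "(\<lambda>n. sqrt (\<delta> + 1 / real (Suc n)) + ip_dist ip (F n) p) \<longlonglongrightarrow> sqrt \<delta>" by simp
    have "ip_dist ip g p \<le> sqrt (\<delta> + 1 / real (Suc n)) + ip_dist ip (F n) p" for n
    proof -
      have "ip_dist ip g (F n) \<le> sqrt (\<delta> + 1 / real (Suc n))"
        using F(2)[of n] by (intro real_le_rsqrt) simp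
      then show ?thesis using ip_dist_triangle[OF g FA pA, of n] by linarith
    qed
    then show "\<exists>N. \<forall>n\<ge>N. ip_dist ip g p \<le> sqrt (\<delta> + 1 / real (Suc n)) + ip_dist ip (F n) p"
      by blast
  qed
  then have min: "(ip_dist ip g p)\<^sup>2 \<le> \<delta>"
    using power_mono[of "ip_dist ip g p" "sqrt \<delta>" 2] d0 ip_dist_nonneg[OF g pA] by simp
  have "ip (\<lambda>x. g x - p x) m = 0" if m: "m \<in> M" for m
  proof -
    let ?r = "\<lambda>x. g x - p x"
    have mA: "m \<in> A" using m M(2) by blast
    have rA: "?r \<in> A" using g pA by (rule diff_mem)
    define s where "s = (norm (ip m ?r))\<^sup>2"
    have "0 \<le> t\<^sup>2 * (s * (ip_norm ip m)\<^sup>2) - 2 * t * s" for t :: real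
    proof -
      \<comment> \<open>The competitor is \<open>p - c m\<close>, whose residual is
        \<open>?r + c m\<close>. As in Cauchy-Schwarz, the conjugate makes the cross term
        real.\<close>
      define c where "c = of_real (- t) * cnj (ip m ?r)"
      have "(\<lambda>x. (- c) * m x + p x) \<in> M" by (rule lin_subspace_lincomb[OF M(1) m p(1)])
      from low[OF this] min have "(ip_norm ip ?r)\<^sup>2 \<le> (ip_norm ip (\<lambda>x. c * m x + ?r x))\<^sup>2"
        by (simp add: ip_dist_def algebra_simps)
      also have "\<dots> = (norm c)\<^sup>2 * (ip_norm ip m)\<^sup>2 + 2 * Re (c * ip m ?r) + (ip_norm ip ?r)\<^sup>2"
        by (rule ip_norm_lincomb_power2[OF mA rA])
      also have "Re (c * ip m ?r) = - t * s"
        by (simp only: c_def s_def Re_scaled_cnj_mult)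
      also have "(norm c)\<^sup>2 = t\<^sup>2 * s"
        by (simp add: c_def s_def norm_mult power_mult_distrib)
      finally show ?thesis by (simp add: mult.assoc)
    qed
    then have "s = 0" by (rule quadratic_nonneg_imp_zero) (auto simp: s_def)
    then show ?thesis using ip_hermitian[OF mA rA] by (simp add: s_def)
  qed
  then show ?thesis using that p(1) by blast
qed

end

section \<open>Feature maps of reproducing kernel spaces\<close>

context hilbert_function_space
begin

sublocale S: semi_inner_space H ip
proof
  show "Re (ip f f) \<ge> 0" if "f \<in> H" for f
  proof (cases "f = (\<lambda>x. 0)")
    case True
    then show ?thesis using ip_linear[of f f f 1] that by simp
  next
    case False
    then show ?thesis using ip_pos[OF that] by simp
  qed
qed (rule zero_mem lincomb_mem ip_linear ip_hermitian; assumption)+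

lemma ip_complete_carrier: "ip_complete ip H"
  using complete by (auto simp: ip_complete_def ip_cauchy_def)

end

text \<open>The Hilbert space core, separated from balls and measures. \<open>M\<close> plays the
  role of the closed span of the \<open>e w\<close>, but is described by properties instead of being
  formed: it is complete, contains every \<open>e w\<close>, and is annihilated by whatever
  annihilates them all. This fits a space that is defined through polynomials rather than through
  the \<open>e w\<close>.\<close>

locale feature_map =
  reproducing_kernel_space X H ip K + B: semi_inner_space B ipB
  for X :: "'x set" and H :: "('x \<Rightarrow> complex) set" and ip :: "'x semi_inner"
    and K :: "'x \<Rightarrow> 'x \<Rightarrow> complex"
    and B :: "('y \<Rightarrow> complex) set" and ipB :: "'y semi_inner" +
  fixes e :: "'x \<Rightarrow> 'y \<Rightarrow> complex" and M :: "('y \<Rightarrow> complex) set"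
  assumes complete_B: "ip_complete ipB B"
    and e_ip: "w \<in> X \<Longrightarrow> z \<in> X \<Longrightarrow> ipB (e w) (e z) = K z w"
    and subspace_M: "lin_subspace M"
    and M_subset: "M \<subseteq> B"
    and complete_M: "ip_complete ipB M"
    and e_mem_M: "w \<in> X \<Longrightarrow> e w \<in> M"
    and total_M: "g \<in> B \<Longrightarrow> (\<And>w. w \<in> X \<Longrightarrow> ipB g (e w) = 0) \<Longrightarrow> m \<in> M \<Longrightarrow> ipB g m = 0"
begin

text \<open>The adjoint of the isometry that sends \<open>k w\<close> to \<open>e w\<close>: by the
  reproducing property its value at \<open>z\<close> can only be the inner product with
  \<open>e z\<close>.\<close>

definition V :: "('y \<Rightarrow> complex) \<Rightarrow> 'x \<Rightarrow> complex" where
  "V g = on_set X (\<lambda>z. ipB g (e z))"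

abbreviation k :: "'x \<Rightarrow> 'x \<Rightarrow> complex" where
  "k w \<equiv> on_set X (\<lambda>z. K z w)"

lemma e_mem: "w \<in> X \<Longrightarrow> e w \<in> B"
  using e_mem_M M_subset by blast

lemma V_lincomb:
  assumes "f \<in> B" "g \<in> B"
  shows "V (\<lambda>x. c * f x + g x) = (\<lambda>z. c * V f z + V g z)"
  using assms by (auto simp: V_def on_set_def B.ip_linear e_mem)

lemma V_diff:
  assumes "f \<in> B" "g \<in> B"
  shows "V (\<lambda>x. f x - g x) = (\<lambda>z. V f z - V g z)"
  using assms by (auto simp: V_def on_set_def B.ip_diff_left e_mem)

lemma V_zero: "V (\<lambda>x. 0) = (\<lambda>z. 0)"
  by (auto simp: V_def on_set_def B.ip_zero_left e_mem)

lemma V_e: "w \<in> X \<Longrightarrow> V (e w) = k w"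
  by (auto simp: V_def on_set_def e_ip)

lemma H_eq_iff:
  assumes "f \<in> H" "g \<in> H"
  shows "f = g \<longleftrightarrow> (\<forall>w\<in>X. f w = g w)"
proof
  assume "\<forall>w\<in>X. f w = g w"
  then have "on_set X f = on_set X g" by (auto simp: on_set_def)
  then show "f = g" using functions_on assms by simp
qed auto

text \<open>Evaluation is an inner product with a kernel function, hence continuous. This identifies
  a limit that completeness provides with a function given by a formula.\<close>

lemma tendsto_eval:
  assumes "\<And>n. F n \<in> H" "f \<in> H" "(\<lambda>n. ip_dist ip (F n) f) \<longlonglongrightarrow> 0" "w \<in> X"
  shows "(\<lambda>n. F n w) \<longlonglongrightarrow> f w"
  using S.ip_tendsto_left[OF assms(1,2) kernel_mem[OF assms(4)] assms(3)] assms
  by (simp add: reproducing)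

text \<open>
  The elements on which \<open>V\<close> behaves as an isometry into \<open>H\<close>, against all \<open>g\<close> with \<open>V g \<in> H\<close>.
  This space is closed, and its orthogonal complement is annihilated by \<open>V\<close>; hence \<open>V\<close> maps
  into \<open>H\<close> altogether.
\<close>

definition N :: "('y \<Rightarrow> complex) set" where
  "N = {t \<in> B. V t \<in> H \<and> (\<forall>g\<in>B. V g \<in> H \<longrightarrow> ip (V g) (V t) = ipB g t)}"

text \<open>Since \<open>V (e w) = k w\<close>, the reproducing property turns the pairing with
  \<open>V g\<close> into the value of \<open>V g\<close> at \<open>w\<close>, which is the inner
  product of \<open>g\<close> with \<open>e w\<close> by definition.\<close>

lemma e_mem_N:
  assumes "w \<in> X" shows "e w \<in> N"
  using assms by (auto simp: N_def V_e e_mem kernel_mem reproducing) (simp add: V_def on_set_def)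

text \<open>Prescribing the pairing with every admissible \<open>g\<close>, rather than just the
  norm of \<open>V t\<close>, is what makes the condition stable under linear combinations.\<close>

lemma subspace_N: "lin_subspace N"
  unfolding lin_subspace_def
proof (intro conjI ballI allI)
  show "(\<lambda>x. 0) \<in> N"
    by (auto simp: N_def V_zero B.zero_mem zero_mem S.ip_zero_right B.ip_zero_right)
next
  fix f g c assume "f \<in> N" "g \<in> N"
  then show "(\<lambda>x. c * f x + g x) \<in> N"
    by (auto simp: N_def V_lincomb B.lincomb_mem lincomb_mem S.ip_linear_right B.ip_linear_right)
qed

lemma norm_V_N: "f \<in> N \<Longrightarrow> ip_norm ip (V f) = ip_norm ipB f"
  by (auto simp: N_def ip_norm_def)

lemma dist_V_N:
  assumes "f \<in> N" "g \<in> N" shows "ip_dist ip (V f) (V g) = ip_dist ipB f g"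
proof -
  have "f \<in> B" "g \<in> B" using assms by (auto simp: N_def)
  then show ?thesis
    using norm_V_N[OF lin_subspace_diff[OF subspace_N assms]]
    by (simp add: ip_dist_def V_diff)
qed

text \<open>\<open>V\<close> preserves distances on \<open>N\<close>, so the images form a Cauchy
  sequence and have a limit \<open>h\<close> in \<open>H\<close>. Values converge on both sides,
  which forces \<open>V t = h\<close>; the pairing identity then passes to the limit.\<close>

lemma closed_N:
  assumes F: "\<And>n. F n \<in> N" and cauchy: "ip_cauchy ipB F"
    and t: "t \<in> B" "(\<lambda>n. ip_dist ipB (F n) t) \<longlonglongrightarrow> 0"
  shows "t \<in> N" "(\<lambda>n. ip_dist ip (V (F n)) (V t)) \<longlonglongrightarrow> 0"
proof -
  have FB: "F n \<in> B" and VF: "V (F n) \<in> H" for n using F[of n] by (auto simp: N_def)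
  have "ip_cauchy ip (\<lambda>n. V (F n))"
    using cauchy by (simp add: ip_cauchy_def dist_V_N F)
  then obtain h where h: "h \<in> H" "(\<lambda>n. ip_dist ip (V (F n)) h) \<longlonglongrightarrow> 0"
    using ip_complete_carrier VF unfolding ip_complete_def by meson
  have "V t = on_set X h"
    unfolding V_def on_set_def
  proof (intro ext if_cong refl)
    fix z assume z: "z \<in> X"
    have "(\<lambda>n. ipB (F n) (e z)) \<longlonglongrightarrow> ipB t (e z)"
      by (rule B.ip_tendsto_left[OF FB t(1) e_mem[OF z] t(2)])
    moreover have "(\<lambda>n. ipB (F n) (e z)) \<longlonglongrightarrow> h z"
      using tendsto_eval[OF VF h(1,2) z] z by (simp add: V_def on_set_def)
    ultimately show "ipB t (e z) = h z" by (rule LIMSEQ_unique)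
  qed
  then have Vt: "V t = h" using functions_on[OF h(1)] by simp
  have "ip (V g) (V t) = ipB g t" if "g \<in> B" "V g \<in> H" for g
  proof (rule LIMSEQ_unique)
    show "(\<lambda>n. ip (V g) (V (F n))) \<longlonglongrightarrow> ip (V g) (V t)"
      unfolding Vt by (rule S.ip_tendsto_right[OF VF h(1) that(2) h(2)])
    have "ip (V g) (V (F n)) = ipB g (F n)" for n using F[of n] that by (auto simp: N_def)
    then show "(\<lambda>n. ip (V g) (V (F n))) \<longlonglongrightarrow> ipB g t"
      using B.ip_tendsto_right[OF FB t(1) that(1) t(2)] by simp
  qed
  then show "t \<in> N" using t(1) h(1) by (simp add: N_def Vt)
  show "(\<lambda>n. ip_dist ip (V (F n)) (V t)) \<longlonglongrightarrow> 0" using h(2) by (simp add: Vt)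
qed

lemma complete_N: "ip_complete ipB N"
  unfolding ip_complete_def
proof (intro allI impI)
  fix F :: "nat \<Rightarrow> 'y \<Rightarrow> complex" assume F: "\<forall>n. F n \<in> N" "ip_cauchy ipB F"
  then have "\<forall>n. F n \<in> B" by (auto simp: N_def)
  then obtain t where "t \<in> B" "(\<lambda>n. ip_dist ipB (F n) t) \<longlonglongrightarrow> 0"
    using complete_B F(2) unfolding ip_complete_def by meson
  then show "\<exists>f\<in>N. (\<lambda>n. ip_dist ipB (F n) f) \<longlonglongrightarrow> 0"
    using closed_N(1)[of F t] F by blast
qed

lemma N_subset: "N \<subseteq> B"
  by (auto simp: N_def)

text \<open>The residual is orthogonal to every \<open>e w\<close>, and these inner products are
  exactly its values under \<open>V\<close>. Hence \<open>V\<close> kills it, and \<open>V g\<close>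
  is the image of an element of \<open>N\<close>.\<close>

lemma decomposition:
  assumes "g \<in> B"
  obtains p where "p \<in> N" "V g = V p" "V (\<lambda>x. g x - p x) = (\<lambda>z. 0)"
    "\<And>m. m \<in> N \<Longrightarrow> ipB (\<lambda>x. g x - p x) m = 0"
proof -
  obtain p where p: "p \<in> N" "\<And>m. m \<in> N \<Longrightarrow> ipB (\<lambda>x. g x - p x) m = 0"
    using B.orthogonal_projection[OF subspace_N N_subset complete_N assms] by blast
  have pB: "p \<in> B" using p(1) by (simp add: N_def)
  have *: "V (\<lambda>x. g x - p x) = (\<lambda>z. 0)"
    using p(2)[OF e_mem_N] by (auto simp: V_def on_set_def)
  then have "V g = V p"
    by (simp add: V_diff[OF assms pB] fun_eq_iff)
  with p * that show ?thesis by blast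
qed

lemma V_mem: "g \<in> B \<Longrightarrow> V g \<in> H"
  by (rule decomposition[of g]) (simp_all add: N_def)

text \<open>The residual of \<open>m\<close> modulo \<open>N\<close> annihilates every
  \<open>e w\<close>, hence \<open>m\<close> by totality, and it annihilates the projection
  \<open>q\<close> as well. So it is orthogonal to itself.\<close>

lemma M_subset_N: "M \<subseteq> N"
proof
  fix m assume m: "m \<in> M"
  then have mB: "m \<in> B" using M_subset by blast
  obtain q where q: "q \<in> N" "\<And>m'. m' \<in> N \<Longrightarrow> ipB (\<lambda>x. m x - q x) m' = 0"
    using decomposition[OF mB] by blast
  let ?r = "\<lambda>x. m x - q x"
  have qB: "q \<in> B" using q(1) by (simp add: N_def)
  have rB: "?r \<in> B" by (rule B.diff_mem[OF mB qB])
  have "ipB ?r m = 0" by (rule total_M[OF rB q(2)[OF e_mem_N] m])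
  then have "ipB ?r ?r = 0" using q(2)[OF q(1)] by (simp add: B.ip_diff_right mB qB rB)
  then have d: "ip_dist ipB m q = 0" by (simp add: ip_dist_def ip_norm_def)
  have "ip_dist ipB q m = 0" using d B.ip_dist_commute[OF mB qB] by simp
  \<comment> \<open>A null residual does not give \<open>m = q\<close>. The constant sequence
    \<open>q\<close> converges to \<open>m\<close> in the seminorm, though, and closedness of
    \<open>N\<close> carries membership over.\<close>
  then have "(\<lambda>n::nat. ip_dist ipB q m) \<longlonglongrightarrow> 0" by simp
  moreover have "ip_cauchy ipB (\<lambda>n. q)"
    by (simp add: ip_cauchy_def B.ip_dist_self)
  ultimately show "m \<in> N"
    using closed_N(1)[of "\<lambda>_. q" m] q(1) mB by blast
qed

lemma V_inner_M:
  assumes "f \<in> B" "g \<in> M" shows "ip (V f) (V g) = ipB f g"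
  using M_subset_N assms V_mem[of f] by (auto simp: N_def)

lemma linear_map_V: "linear_map B H ip V"
  by (simp add: linear_map_def V_mem V_lincomb S.ip_dist_self)

text \<open>The bound is Pythagoras for the projection onto \<open>N\<close>. For a vector
  orthogonal to the kernel of \<open>V\<close> the residual has norm 0, so the vector and its
  projection have equal norms.\<close>

lemma partial_isometry_V: "partial_isometry B ipB H ip V"
proof -
  have decomp_norm: "(ip_norm ipB g)\<^sup>2 = (ip_norm ipB p)\<^sup>2 + (ip_norm ipB (\<lambda>x. g x - p x))\<^sup>2"
    if "g \<in> B" "p \<in> B" "ipB (\<lambda>x. g x - p x) p = 0" for g p
    using B.ip_norm_lincomb_power2[of "\<lambda>x. g x - p x" p 1] that by (simp add: B.diff_mem)
  have bound: "ip_norm ip (V g) \<le> 1 * ip_norm ipB g" if g: "g \<in> B" for g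
  proof -
    obtain p where p: "p \<in> N" "V g = V p" "\<And>m. m \<in> N \<Longrightarrow> ipB (\<lambda>x. g x - p x) m = 0"
      using decomposition[OF g] by blast
    have pB: "p \<in> B" using p(1) by (simp add: N_def)
    have "(ip_norm ipB p)\<^sup>2 \<le> (ip_norm ipB g)\<^sup>2"
      using decomp_norm[OF g pB p(3)[OF p(1)]] by simp
    then have "ip_norm ipB p \<le> ip_norm ipB g"
      using power2_le_imp_le B.ip_norm_nonneg[OF g] by blast
    then show ?thesis using p(2) norm_V_N[OF p(1)] by simp
  qed
  have isom: "ip_norm ip (V f) = ip_norm ipB f"
    if f: "f \<in> B" and orth: "\<forall>g\<in>B. ip_norm ip (V g) = 0 \<longrightarrow> ipB f g = 0" for f
  proof -
    obtain p where p: "p \<in> N" "V f = V p" "V (\<lambda>x. f x - p x) = (\<lambda>z. 0)"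
      "\<And>m. m \<in> N \<Longrightarrow> ipB (\<lambda>x. f x - p x) m = 0"
      using decomposition[OF f] by blast
    let ?r = "\<lambda>x. f x - p x"
    have pB: "p \<in> B" using p(1) by (simp add: N_def)
    have rB: "?r \<in> B" by (rule B.diff_mem[OF f pB])
    \<comment> \<open>The residual itself lies in the kernel of \<open>V\<close>, so the
      orthogonality assumption applies to it.\<close>
    have "ipB f ?r = 0"
      using orth rB p(3) by (simp add: ip_norm_def S.ip_zero_left zero_mem)
    moreover have "ipB p ?r = 0"
      using B.ip_hermitian[OF rB pB] p(4)[OF p(1)] by simp
    ultimately have "ipB ?r ?r = 0" by (simp add: B.ip_diff_left f pB rB)
    then have "(ip_norm ipB f)\<^sup>2 = (ip_norm ipB p)\<^sup>2"
      using decomp_norm[OF f pB p(4)[OF p(1)]] by (simp add: ip_norm_def)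
    then have "ip_norm ipB f = ip_norm ipB p"
      using B.ip_norm_nonneg f pB by (simp add: power2_eq_iff_nonneg)
    then show ?thesis using p(2) norm_V_N[OF p(1)] by simp
  qed
  show ?thesis
    unfolding partial_isometry_def using linear_map_V bound isom by blast
qed

text \<open>A distance-preserving image of the complete space \<open>M\<close> is complete, so
  \<open>f\<close> can be projected onto it. The residual is orthogonal to every kernel function and
  therefore vanishes at every point of \<open>X\<close>.\<close>

lemma V_onto:
  assumes f: "f \<in> H"
  obtains p where "p \<in> M" "V p = f"
proof -
  have MB: "m \<in> B" if "m \<in> M" for m using that M_subset by blast
  have sub: "lin_subspace (V ` M)"
    unfolding lin_subspace_def
  proof (intro conjI ballI allI)
    show "(\<lambda>z. 0) \<in> V ` M"
      using imageI[OF lin_subspace_zero[OF subspace_M], of V] by (simp add: V_zero)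
    fix f g c assume "f \<in> V ` M" "g \<in> V ` M"
    then obtain p q where p: "p \<in> M" "q \<in> M" and fg: "f = V p" "g = V q" by blast
    show "(\<lambda>x. c * f x + g x) \<in> V ` M"
      unfolding fg V_lincomb[OF MB[OF p(1)] MB[OF p(2)], symmetric]
      by (intro imageI lin_subspace_lincomb subspace_M p)
  qed
  have comp: "ip_complete ip (V ` M)"
    unfolding ip_complete_def
  proof (intro allI impI)
    fix F :: "nat \<Rightarrow> 'x \<Rightarrow> complex" assume F: "\<forall>n. F n \<in> V ` M" "ip_cauchy ip F"
    then have "\<forall>n. \<exists>p. p \<in> M \<and> F n = V p" by blast
    then obtain P where P: "\<And>n. P n \<in> M" "\<And>n. F n = V (P n)" by metis
    have PN: "P n \<in> N" for n using P(1) M_subset_N by blast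
    have c: "ip_cauchy ipB P" using F(2) by (simp add: ip_cauchy_def P(2) dist_V_N PN)
    then obtain t where t: "t \<in> M" "(\<lambda>n. ip_dist ipB (P n) t) \<longlonglongrightarrow> 0"
      using complete_M P(1) unfolding ip_complete_def by meson
    then show "\<exists>f\<in>V ` M. (\<lambda>n. ip_dist ip (F n) f) \<longlonglongrightarrow> 0"
      using closed_N(2)[OF PN c MB t(2)] by (auto simp: P(2))
  qed
  have "V ` M \<subseteq> H" using MB V_mem by blast
  then obtain q where q: "q \<in> V ` M" "\<And>m. m \<in> V ` M \<Longrightarrow> ip (\<lambda>x. f x - q x) m = 0"
    using S.orthogonal_projection[OF sub _ comp f] by blast
  have qH: "q \<in> H" using q(1) MB V_mem by blast
  have "f w = q w" if w: "w \<in> X" for w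
  proof -
    have "k w \<in> V ` M" using imageI[OF e_mem_M[OF w], of V] by (simp add: V_e[OF w])
    from q(2)[OF this] show ?thesis
      using reproducing[OF S.diff_mem[OF f qH] w] by simp
  qed
  then have "f = q" using H_eq_iff[OF f qH] by blast
  then show ?thesis using q(1) that by blast
qed

text \<open>Preimages in \<open>M\<close> are determined only up to distance 0, so one is chosen.
  Linearity then holds only up to distance 0, which is how \<open>linear_map\<close> is
  formulated.\<close>

definition U :: "('x \<Rightarrow> complex) \<Rightarrow> 'y \<Rightarrow> complex" where
  "U f = (SOME p. p \<in> M \<and> V p = f)"

lemma U_mem: "f \<in> H \<Longrightarrow> U f \<in> M"
  and V_U: "f \<in> H \<Longrightarrow> V (U f) = f"
  using V_onto[of f] someI_ex[of "\<lambda>p. p \<in> M \<and> V p = f"] unfolding U_def by blast+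

lemma dist_M_eq_zero:
  assumes "p \<in> M" "q \<in> M" "V p = V q" shows "ip_dist ipB p q = 0"
  using dist_V_N[of p q] assms M_subset_N S.ip_dist_self by (simp add: subset_iff)

lemma dist_U_kernel: "w \<in> X \<Longrightarrow> ip_dist ipB (U (k w)) (e w) = 0"
  by (intro dist_M_eq_zero) (simp_all add: U_mem V_U kernel_mem e_mem_M V_e)

lemma unitary_U: "unitary_map H ip M ipB U"
  unfolding unitary_map_def linear_map_def
proof (intro conjI ballI allI)
  show "U f \<in> M" if "f \<in> H" for f using that by (rule U_mem)
next
  fix f g c assume "f \<in> H" "g \<in> H"
  then show "ip_dist ipB (U (\<lambda>x. c * f x + g x)) (\<lambda>y. c * U f y + U g y) = 0"
    using M_subset lin_subspace_lincomb[OF subspace_M U_mem U_mem]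
    by (intro dist_M_eq_zero) (simp_all add: U_mem V_U lincomb_mem V_lincomb subset_iff)
next
  fix f g assume "f \<in> H" "g \<in> H"
  then show "ipB (U f) (U g) = ip f g"
    using V_inner_M[of "U f" "U g"] M_subset by (simp add: U_mem V_U subset_iff)
next
  fix h assume "h \<in> M"
  then show "\<exists>f\<in>H. ip_dist ipB (U f) h = 0"
    using M_subset
    by (intro bexI[of _ "V h"] dist_M_eq_zero) (auto simp: U_mem V_U V_mem subset_iff)
qed

text \<open>It covers every unitary with the prescribed values on kernel functions, not just
  \<open>U\<close>. If \<open>T h\<close> represents \<open>g\<close>, then pairing with
  \<open>T (k w)\<close> and using unitarity gives \<open>h w = V g w\<close>; so \<open>V\<close>
  inverts \<open>T\<close>, and the inverse of a unitary is its adjoint.\<close>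

lemma adjoint_V:
  assumes T: "unitary_map H ip M ipB T"
    and Tk: "\<And>w. w \<in> X \<Longrightarrow> ip_dist ipB (T (k w)) (e w) = 0"
  shows "is_adjoint H ip M ipB T V"
  unfolding is_adjoint_def
proof (intro conjI ballI)
  show "V g \<in> H" if "g \<in> M" for g using that M_subset V_mem by blast
next
  fix f g assume f: "f \<in> H" and g: "g \<in> M"
  have TM: "T f \<in> M" if "f \<in> H" for f using T that by (simp add: unitary_map_def linear_map_def)
  have TB: "T f \<in> B" if "f \<in> H" for f using TM[OF that] M_subset by blast
  have gB: "g \<in> B" using g M_subset by blast
  obtain h where h: "h \<in> H" "ip_dist ipB (T h) g = 0"
    using T g unfolding unitary_map_def by blast
  have gTh: "ip_dist ipB g (T h) = 0"
    using h B.ip_dist_commute[OF TB gB] by simp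
  have "V g w = h w" if w: "w \<in> X" for w
  proof -
    have "h w = ip h (k w)" using h(1) w by (simp add: reproducing)
    also have "\<dots> = ipB (T h) (T (k w))"
      using T h(1) kernel_mem[OF w] by (simp add: unitary_map_def)
    also have "\<dots> = ipB g (T (k w))"
      by (rule B.ip_eq_of_dist_zero[OF TB gB TB h(2)]) (use h kernel_mem[OF w] in auto)
    also have "\<dots> = cnj (ipB (T (k w)) g)"
      by (rule B.ip_hermitian[OF TB gB]) (rule kernel_mem[OF w])
    also have "ipB (T (k w)) g = ipB (e w) g"
      by (rule B.ip_eq_of_dist_zero[OF TB e_mem gB Tk])
        (use w kernel_mem[OF w] in auto)
    also have "cnj (ipB (e w) g) = ipB g (e w)"
      using B.ip_hermitian[OF e_mem[OF w] gB] by simp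
    finally show ?thesis using w by (simp add: V_def on_set_def)
  qed
  then have Vg: "V g = h" using H_eq_iff[OF V_mem[OF gB] h(1)] by blast
  have "ipB (T f) g = cnj (ipB g (T f))" by (rule B.ip_hermitian[OF gB TB[OF f]])
  also have "ipB g (T f) = ipB (T h) (T f)"
    by (rule B.ip_eq_of_dist_zero[OF gB TB[OF h(1)] TB[OF f] gTh])
  also have "cnj (ipB (T h) (T f)) = ipB (T f) (T h)"
    by (rule B.ip_hermitian[OF TB[OF h(1)] TB[OF f], symmetric])
  also have "\<dots> = ip f (V g)"
    using T f h(1) by (simp add: unitary_map_def Vg)
  finally show "ipB (T f) g = ip f (V g)" .
qed

end

section \<open>The space \<open>L\<^sup>2\<close>\<close>

lemma L2_measurable: "f \<in> L2_space M \<Longrightarrow> f \<in> borel_measurable M"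
  and L2_integrable_square: "f \<in> L2_space M \<Longrightarrow> integrable M (\<lambda>x. (norm (f x))\<^sup>2)"
  by (simp_all add: L2_space_def)

lemma L2_integrable_mult:
  assumes "f \<in> L2_space M" "g \<in> L2_space M"
  shows "integrable M (\<lambda>x. f x * cnj (g x))"
proof (rule Bochner_Integration.integrable_bound)
  show "integrable M (\<lambda>x. (norm (f x))\<^sup>2 + (norm (g x))\<^sup>2)"
    using assms by (simp add: L2_integrable_square)
  have [measurable]: "f \<in> borel_measurable M" "g \<in> borel_measurable M"
    using assms by (simp_all add: L2_measurable)
  have [measurable]: "(\<lambda>x. cnj (g x)) \<in> borel_measurable M"
    by (rule borel_measurable_continuous_on[of cnj]) (auto intro: continuous_intros)
  show "(\<lambda>x. f x * cnj (g x)) \<in> borel_measurable M"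
    by measurable
  have "norm (f x * cnj (g x)) \<le> norm ((norm (f x))\<^sup>2 + (norm (g x))\<^sup>2)" for x
    using sum_squares_bound[of "norm (f x)" "norm (g x)"]
      mult_nonneg_nonneg[OF norm_ge_zero[of "f x"] norm_ge_zero[of "g x"]]
    unfolding norm_mult complex_mod_cnj real_norm_def by linarith
  then show "AE x in M. norm (f x * cnj (g x)) \<le> norm ((norm (f x))\<^sup>2 + (norm (g x))\<^sup>2)"
    by simp
qed

lemma L2_lincomb:
  assumes "f \<in> L2_space M" "g \<in> L2_space M"
  shows "(\<lambda>x. c * f x + g x) \<in> L2_space M"
proof -
  have [measurable]: "f \<in> borel_measurable M" "g \<in> borel_measurable M"
    using assms by (simp_all add: L2_measurable)
  have "integrable M (\<lambda>x. (norm (c * f x + g x))\<^sup>2)"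
  proof (rule Bochner_Integration.integrable_bound)
    show "integrable M (\<lambda>x. 2 * (norm c)\<^sup>2 * (norm (f x))\<^sup>2 + 2 * (norm (g x))\<^sup>2)"
      using assms by (simp add: L2_integrable_square)
    have "(norm (c * f x + g x))\<^sup>2 \<le> 2 * (norm c)\<^sup>2 * (norm (f x))\<^sup>2 + 2 * (norm (g x))\<^sup>2" for x
    proof -
      have "(norm (c * f x + g x))\<^sup>2 \<le> (norm (c * f x) + norm (g x))\<^sup>2"
        by (intro power_mono norm_triangle_ineq norm_ge_zero)
      also have "\<dots> \<le> 2 * (norm (c * f x))\<^sup>2 + 2 * (norm (g x))\<^sup>2"
        using sum_squares_bound[of "norm (c * f x)" "norm (g x)"] by (simp add: power2_sum)
      finally show ?thesis by (simp add: norm_mult power_mult_distrib)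
    qed
    then show "AE x in M. norm ((norm (c * f x + g x))\<^sup>2) \<le>
        norm (2 * (norm c)\<^sup>2 * (norm (f x))\<^sup>2 + 2 * (norm (g x))\<^sup>2)"
      by simp
  qed measurable
  then show ?thesis by (simp add: L2_space_def)
qed

lemma L2_inner_self: "L2_inner M f f = of_real (\<integral>x. (norm (f x))\<^sup>2 \<partial>M)"
  by (simp add: L2_inner_def flip: complex_norm_square integral_complex_of_real)

lemma L2_norm: "ip_norm (L2_inner M) f = sqrt (\<integral>x. (norm (f x))\<^sup>2 \<partial>M)"
  by (simp add: ip_norm_def L2_inner_self)

interpretation L2: semi_inner_space "L2_space M" "L2_inner M"
proof
  show "(\<lambda>x. 0) \<in> L2_space M" by (simp add: L2_space_def)
  show "(\<lambda>x. c * f x + g x) \<in> L2_space M" if "f \<in> L2_space M" "g \<in> L2_space M" for c f g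
    using that by (rule L2_lincomb)
  show "L2_inner M (\<lambda>x. c * f x + g x) h = c * L2_inner M f h + L2_inner M g h"
    if "f \<in> L2_space M" "g \<in> L2_space M" "h \<in> L2_space M" for c f g h
    using that L2_integrable_mult[of f M h] L2_integrable_mult[of g M h]
    by (simp add: L2_inner_def algebra_simps)
  show "L2_inner M g f = cnj (L2_inner M f g)" if "f \<in> L2_space M" "g \<in> L2_space M" for f g
    unfolding L2_inner_def Bochner_Integration.integral_cnj[symmetric]
    by (intro Bochner_Integration.integral_cong) (simp_all add: mult.commute)
  show "Re (L2_inner M f f) \<ge> 0" if "f \<in> L2_space M" for f
    by (simp add: L2_inner_self)
qed

lemma nn_integral_L2_norm:
  assumes "f \<in> L2_space M"
  shows "(\<integral>\<^sup>+x. ennreal ((norm (f x))\<^sup>2) \<partial>M) = ennreal ((ip_norm (L2_inner M) f)\<^sup>2)"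
  using assms by (simp add: nn_integral_eq_integral L2_integrable_square L2_norm)

text \<open>Starting from a nonnegative integral, membership and the norm bound come out together;
  this is the shape in which Fatou's lemma delivers its estimate.\<close>

lemma L2_norm_le:
  assumes [measurable]: "f \<in> borel_measurable M"
    and "(\<integral>\<^sup>+x. ennreal ((norm (f x))\<^sup>2) \<partial>M) \<le> ennreal (C\<^sup>2)" "C \<ge> 0"
  shows "f \<in> L2_space M" "ip_norm (L2_inner M) f \<le> C"
proof -
  have "(\<integral>\<^sup>+x. ennreal ((norm (f x))\<^sup>2) \<partial>M) < \<infinity>"
    using assms(2) by (simp add: le_less_trans)
  then show f: "f \<in> L2_space M"
    by (simp add: L2_space_def integrable_iff_bounded)
  have "(ip_norm (L2_inner M) f)\<^sup>2 \<le> C\<^sup>2"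
    using assms(2) by (simp add: nn_integral_L2_norm[OF f])
  then show "ip_norm (L2_inner M) f \<le> C"
    using assms(3) by (rule power2_le_imp_le)
qed

lemma L2_dist_zero_AE:
  assumes "f \<in> L2_space M" "g \<in> L2_space M" "ip_dist (L2_inner M) f g = 0"
  shows "AE x in M. f x = g x"
proof -
  have "(\<lambda>x. f x - g x) \<in> L2_space M" using assms(1,2) by (rule L2.diff_mem)
  then have "integrable M (\<lambda>x. (norm (f x - g x))\<^sup>2)" by (rule L2_integrable_square)
  moreover have "(\<integral>x. (norm (f x - g x))\<^sup>2 \<partial>M) = 0"
    using assms(3) by (simp add: ip_dist_def L2_norm)
  ultimately have "AE x in M. (norm (f x - g x))\<^sup>2 = 0"
    by (subst (asm) integral_nonneg_eq_0_iff_AE) auto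
  then show ?thesis by simp
qed

lemma L2_AE_dist_zero:
  assumes "AE x in M. f x = g x"
  shows "ip_dist (L2_inner M) f g = 0"
proof -
  have "(\<integral>x. (norm (f x - g x))\<^sup>2 \<partial>M) = 0"
    using assms by (intro integral_eq_zero_AE) auto
  then show ?thesis by (simp add: ip_dist_def L2_norm)
qed

lemma bounded_mem_L2:
  assumes "finite_measure M" "f \<in> borel_measurable M" "\<And>x. x \<in> space M \<Longrightarrow> norm (f x) \<le> C"
  shows "f \<in> L2_space M"
proof -
  interpret finite_measure M by fact
  have [measurable]: "f \<in> borel_measurable M" by fact
  have "integrable M (\<lambda>x. (norm (f x))\<^sup>2)"
    by (rule integrable_const_bound[of _ "C\<^sup>2"])
      (use assms(3) in \<open>auto intro!: AE_I2 power_mono\<close>)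
  then show ?thesis using assms(2) by (simp add: L2_space_def)
qed

lemma L2_integrable:
  fixes f :: "'a \<Rightarrow> complex"
  assumes "finite_measure M" "f \<in> L2_space M"
  shows "integrable M f"
  using L2_integrable_mult[OF assms(2) bounded_mem_L2[OF assms(1), of "\<lambda>x. 1" 1]] by simp

text \<open>Square integrability controls squared steps, while convergence needs the steps
  themselves. The weights bridge this: \<open>2 * d \<le> 2 ^ n * d\<^sup>2 + (1/2) ^ n\<close>, and
  the last term is summable.\<close>

lemma convergent_of_summable_squares:
  fixes G :: "nat \<Rightarrow> complex"
  assumes "summable (\<lambda>n. 2 ^ n * (norm (G (Suc n) - G n))\<^sup>2)"
  shows "convergent G"
proof -
  have *: "summable (\<lambda>n. (2 ^ n * (norm (G (Suc n) - G n))\<^sup>2 + (1/2) ^ n) / 2)"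
    using assms by (intro summable_divide summable_add summable_geometric) auto
  have "norm (G (Suc n) - G n) \<le> (2 ^ n * (norm (G (Suc n) - G n))\<^sup>2 + (1/2) ^ n) / 2" for n
  proof -
    define a d :: real where "a = 2 ^ n" and "d = norm (G (Suc n) - G n)"
    have "a > 0" "(1/2) ^ n = 1 / a" by (simp_all add: a_def power_one_over)
    moreover have "0 \<le> (a * d - 1)\<^sup>2 / a" using \<open>a > 0\<close> by simp
    ultimately have "2 * d \<le> a * d\<^sup>2 + (1/2) ^ n"
      by (simp add: power2_eq_square field_simps)
    then show ?thesis by (simp add: a_def d_def)
  qed
  then have "summable (\<lambda>n. G (Suc n) - G n)"
    by (rule summable_comparison_test'[OF *, of 0])
  then have "convergent (\<lambda>n. \<Sum>i<n. G (Suc i) - G i)"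
    by (simp add: summable_iff_convergent)
  then have "convergent (\<lambda>n. (G n - G 0) + G 0)"
    by (intro convergent_add convergent_const) (simp add: sum_lessThan_telescope)
  then show ?thesis by simp
qed

text \<open>Riesz-Fischer. Along a subsequence with steps below \<open>(1/2) ^ n\<close> the squared
  steps, weighted by \<open>2 ^ n\<close>, still have integral at most \<open>(1/2) ^ n\<close>.
  Their sum is finite almost everywhere, which gives a pointwise limit, and Fatou's lemma upgrades
  it to a limit in norm.\<close>

theorem L2_complete: "ip_complete (L2_inner M) (L2_space M)"
  unfolding ip_complete_def
proof (intro allI impI)
  fix F :: "nat \<Rightarrow> 'a \<Rightarrow> complex"
  assume F: "\<forall>n. F n \<in> L2_space M" and cauchy: "ip_cauchy (L2_inner M) F"
  let ?d = "ip_dist (L2_inner M)"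
  have [measurable]: "F n \<in> borel_measurable M" for n using F by (simp add: L2_measurable)
  have "\<forall>k. \<exists>N. \<forall>m\<ge>N. \<forall>n\<ge>N. ?d (F m) (F n) < (1/2) ^ k"
    using cauchy by (simp add: ip_cauchy_def)
  then obtain s where s: "\<And>k m n. m \<ge> s k \<Longrightarrow> n \<ge> s k \<Longrightarrow> ?d (F m) (F n) < (1/2) ^ k"
    by metis
  \<comment> \<open>Partial sums dominate all earlier thresholds at once, so \<open>s\<close> itself
    does not have to be monotone.\<close>
  define r where "r n = (\<Sum>i\<le>n. s i)" for n
  have r: "s k \<le> r n" if "k \<le> n" for k n
    using that unfolding r_def by (intro member_le_sum) auto
  define G where "G n = F (r n)" for n
  have [measurable]: "G n \<in> borel_measurable M" for n by (simp add: G_def)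
  have step: "?d (G (Suc n)) (G n) < (1/2) ^ n" for n
    unfolding G_def by (intro s r) auto
  have "(\<integral>\<^sup>+x. (\<Sum>n. ennreal (2 ^ n * (norm (G (Suc n) x - G n x))\<^sup>2)) \<partial>M)
      = (\<Sum>n. \<integral>\<^sup>+x. ennreal (2 ^ n * (norm (G (Suc n) x - G n x))\<^sup>2) \<partial>M)"
    by (intro nn_integral_suminf) measurable
  also have "\<dots> \<le> (\<Sum>n. ennreal ((1/2) ^ n))"
  proof (intro suminf_le summableI)
    fix n
    have GL: "(\<lambda>x. G (Suc n) x - G n x) \<in> L2_space M"
      using F by (intro L2.diff_mem) (auto simp: G_def)
    have "(?d (G (Suc n)) (G n))\<^sup>2 \<le> ((1/2) ^ n)\<^sup>2"
      using step[of n] L2.ip_norm_nonneg[OF GL] by (intro power_mono) (auto simp: ip_dist_def)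
    then have "2 ^ n * (?d (G (Suc n)) (G n))\<^sup>2 \<le> 2 ^ n * ((1/2) ^ n)\<^sup>2"
      by (intro mult_left_mono) auto
    also have "\<dots> = (1/2) ^ n" by (simp add: power2_eq_square power_one_over)
    finally have *: "2 ^ n * (?d (G (Suc n)) (G n))\<^sup>2 \<le> (1/2) ^ n" .
    have "(\<integral>\<^sup>+x. ennreal (2 ^ n * (norm (G (Suc n) x - G n x))\<^sup>2) \<partial>M)
        = ennreal (2 ^ n) * (\<integral>\<^sup>+x. ennreal ((norm (G (Suc n) x - G n x))\<^sup>2) \<partial>M)"
      by (subst nn_integral_cmult[symmetric]) (auto simp: ennreal_mult)
    also have "\<dots> = ennreal (2 ^ n * (?d (G (Suc n)) (G n))\<^sup>2)"
      by (subst nn_integral_L2_norm[OF GL]) (simp add: ennreal_mult ip_dist_def)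
    finally show "(\<integral>\<^sup>+x. ennreal (2 ^ n * (norm (G (Suc n) x - G n x))\<^sup>2) \<partial>M) \<le> ennreal ((1/2) ^ n)"
      using * by (simp add: ennreal_leI)
  qed
  also have "\<dots> = ennreal (\<Sum>n. (1/2) ^ n)"
    by (intro suminf_ennreal2 summable_geometric) auto
  also have "\<dots> < \<infinity>" by simp
  finally have "AE x in M. (\<Sum>n. ennreal (2 ^ n * (norm (G (Suc n) x - G n x))\<^sup>2)) \<noteq> \<infinity>"
    by (intro nn_integral_PInf_AE) auto
  then have conv: "AE x in M. convergent (\<lambda>n. G n x)"
  proof (eventually_elim)
    case (elim x)
    then show ?case
      by (intro convergent_of_summable_squares summable_suminf_not_top) auto
  qed
  define f where "f x = lim (\<lambda>n. G n x)" for x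
  have [measurable]: "f \<in> borel_measurable M" unfolding f_def by measurable
  \<comment> \<open>Fatou's lemma with \<open>m\<close> fixed: the distance from \<open>F m\<close>
    to \<open>G j\<close> is below \<open>(1/2) ^ k\<close> as soon as
    \<open>j \<ge> k\<close>.\<close>
  have bound: "(\<integral>\<^sup>+x. ennreal ((norm (F m x - f x))\<^sup>2) \<partial>M) \<le> ennreal (((1/2) ^ k)\<^sup>2)"
    if m: "m \<ge> s k" for m k
  proof -
    have "AE x in M. ennreal ((norm (F m x - f x))\<^sup>2)
        = liminf (\<lambda>j. ennreal ((norm (F m x - G j x))\<^sup>2))"
      using conv
    proof (eventually_elim)
      case (elim x)
      then have "(\<lambda>j. G j x) \<longlonglongrightarrow> f x" by (simp add: f_def convergent_LIMSEQ_iff)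
      then have "(\<lambda>j. ennreal ((norm (F m x - G j x))\<^sup>2)) \<longlonglongrightarrow> ennreal ((norm (F m x - f x))\<^sup>2)"
        by (intro tendsto_ennrealI tendsto_intros)
      then show ?case by (intro lim_imp_Liminf[symmetric]) auto
    qed
    then have "(\<integral>\<^sup>+x. ennreal ((norm (F m x - f x))\<^sup>2) \<partial>M)
        = (\<integral>\<^sup>+x. liminf (\<lambda>j. ennreal ((norm (F m x - G j x))\<^sup>2)) \<partial>M)"
      by (rule nn_integral_cong_AE)
    also have "\<dots> \<le> liminf (\<lambda>j. \<integral>\<^sup>+x. ennreal ((norm (F m x - G j x))\<^sup>2) \<partial>M)"
      by (intro nn_integral_liminf) measurable
    also have "\<dots> \<le> ennreal (((1/2) ^ k)\<^sup>2)"
    proof (rule Liminf_le)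
      have "(\<integral>\<^sup>+x. ennreal ((norm (F m x - G j x))\<^sup>2) \<partial>M) \<le> ennreal (((1/2) ^ k)\<^sup>2)" if j: "j \<ge> k" for j
      proof -
        have L: "(\<lambda>x. F m x - G j x) \<in> L2_space M"
          using F by (intro L2.diff_mem) (auto simp: G_def)
        have "?d (F m) (G j) < (1/2) ^ k"
          unfolding G_def using m r[OF j] by (intro s)
        then show ?thesis
          using L2.ip_norm_nonneg[OF L]
          by (subst nn_integral_L2_norm[OF L]) (auto simp: ip_dist_def intro!: ennreal_leI power_mono)
      qed
      then show "\<forall>\<^sub>F j in sequentially.
          (\<integral>\<^sup>+x. ennreal ((norm (F m x - G j x))\<^sup>2) \<partial>M) \<le> ennreal (((1/2) ^ k)\<^sup>2)"
        by (auto simp: eventually_sequentially)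
    qed simp
    finally show ?thesis .
  qed
  have diff: "(\<lambda>x. F m x - f x) \<in> L2_space M" "?d (F m) f \<le> (1/2) ^ k" if "m \<ge> s k" for m k
    using L2_norm_le[OF _ bound[OF that]] by (auto simp: ip_dist_def)
  \<comment> \<open>\<open>f\<close> is recovered as the difference of \<open>F (s 0)\<close> and
    \<open>F (s 0) - f\<close>, both square integrable.\<close>
  have fL: "f \<in> L2_space M"
    using L2.diff_mem[OF F[rule_format, of "s 0"] diff(1)[OF order_refl, of 0]] by simp
  have "(\<lambda>n. ?d (F n) f) \<longlonglongrightarrow> 0"
  proof (rule LIMSEQ_I)
    fix e :: real assume "e > 0"
    then obtain k where k: "(1/2) ^ k < e"
      using real_arch_pow_inv[of e "1/2"] by auto
    have "norm (?d (F n) f - 0) < e" if "n \<ge> s k" for n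
      using diff(2)[OF that] k L2.ip_dist_nonneg[of "F n" M f] F fL by simp
    then show "\<exists>N. \<forall>n\<ge>N. norm (?d (F n) f - 0) < e" by blast
  qed
  with fL show "\<exists>f\<in>L2_space M. (\<lambda>n. ?d (F n) f) \<longlonglongrightarrow> 0" by blast
qed

section \<open>Holomorphic dependence of integrals on a parameter\<close>

text \<open>A bound on \<open>K\<close> alone suffices. Discs of radius \<open>r/4\<close> about
  points of the half ball stay inside the full ball, so Cauchy's estimate bounds the derivative by
  \<open>4 * h x / r\<close>; this dominates the difference quotients.\<close>

lemma has_field_derivative_integral_dominated:
  fixes K :: "complex \<Rightarrow> 'a \<Rightarrow> complex"
  assumes r: "r > 0"
    and meas: "\<And>z. z \<in> ball z0 r \<Longrightarrow> K z \<in> borel_measurable M"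
    and hol: "\<And>x. x \<in> space M \<Longrightarrow> (\<lambda>z. K z x) holomorphic_on ball z0 r"
    and dom: "\<And>z x. z \<in> ball z0 r \<Longrightarrow> x \<in> space M \<Longrightarrow> norm (K z x) \<le> h x"
    and h: "integrable M h"
  shows "((\<lambda>z. \<integral>x. K z x \<partial>M) has_field_derivative (\<integral>x. deriv (\<lambda>z. K z x) z0 \<partial>M)) (at z0)"
proof -
  have sub: "ball z0 (r/2) \<subseteq> ball z0 r" using r by (intro subset_ball) simp
  have int: "integrable M (K z)" if "z \<in> ball z0 r" for z
    using dom[OF that] by (intro Bochner_Integration.integrable_bound[OF h meas[OF that]])
      (force intro!: AE_I2)
  have lip: "norm ((K z x - K z0 x) / (z - z0)) \<le> 4 * h x / r"
    if x: "x \<in> space M" and z: "z \<in> ball z0 (r/2)" "z \<noteq> z0" for x z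
  proof -
    have "norm (K z x - K z0 x) \<le> (4 * h x / r) * norm (z - z0)"
    proof (rule field_differentiable_bound[where S = "ball z0 (r/2)" and f' = "deriv (\<lambda>z. K z x)"])
      fix u assume u: "u \<in> ball z0 (r/2)"
      have uball: "cball u (r/4) \<subseteq> ball z0 r"
      proof
        fix v assume "v \<in> cball u (r/4)"
        then show "v \<in> ball z0 r"
          using u r dist_triangle[of z0 v u] by (simp add: mem_ball mem_cball)
      qed
      show "((\<lambda>z. K z x) has_field_derivative deriv (\<lambda>z. K z x) u) (at u within ball z0 (r/2))"
        using hol[OF x] u sub
        by (meson has_field_derivative_at_within holomorphic_derivI open_ball subsetD)
      have "norm ((deriv ^^ 1) (\<lambda>z. K z x) u) \<le> fact 1 * h x / (r/4) ^ 1"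
      proof (rule Cauchy_inequality)
        show "(\<lambda>z. K z x) holomorphic_on ball u (r/4)"
          using uball ball_subset_cball by (intro holomorphic_on_subset[OF hol[OF x]]) blast
        show "continuous_on (cball u (r/4)) (\<lambda>z. K z x)"
          by (intro holomorphic_on_imp_continuous_on holomorphic_on_subset[OF hol[OF x] uball])
        show "norm (K v x) \<le> h x" if "norm (u - v) = r/4" for v
          using that uball by (intro dom x) (auto simp: subset_iff mem_cball dist_norm)
      qed (use r in simp)
      then show "norm (deriv (\<lambda>z. K z x) u) \<le> 4 * h x / r" by (simp add: mult.commute)
    qed (use z r in auto)
    then show ?thesis using z by (simp add: norm_divide divide_le_eq)
  qed
  have "((\<lambda>z. \<integral>x. K z x \<partial>M) has_field_derivative (\<integral>x. deriv (\<lambda>z. K z x) z0 \<partial>M))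
      (at z0 within ball z0 (r/2))"
    unfolding has_field_derivative_iff tendsto_at_iff_sequentially comp_def
  proof (intro allI impI)
    fix X assume X: "\<forall>i. X i \<in> ball z0 (r/2) - {z0}" "X \<longlonglongrightarrow> z0"
    have Xr: "X i \<in> ball z0 r" for i using X(1) sub by blast
    have z0r: "z0 \<in> ball z0 r" using r by simp
    have lim: "(\<lambda>i. (K (X i) x - K z0 x) / (X i - z0)) \<longlonglongrightarrow> deriv (\<lambda>z. K z x) z0"
      if x: "x \<in> space M" for x
    proof -
      have "((\<lambda>z. K z x) has_field_derivative deriv (\<lambda>z. K z x) z0) (at z0)"
        by (rule holomorphic_derivI[OF hol[OF x] open_ball z0r])
      then show ?thesis
        using X unfolding has_field_derivative_iff tendsto_at_iff_sequentially comp_def by auto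
    qed
    have m: "(\<lambda>x. (K (X i) x - K z0 x) / (X i - z0)) \<in> borel_measurable M" for i
      using meas[OF Xr] meas[OF z0r] by measurable
    have "(\<lambda>i. \<integral>x. (K (X i) x - K z0 x) / (X i - z0) \<partial>M) \<longlonglongrightarrow> (\<integral>x. deriv (\<lambda>z. K z x) z0 \<partial>M)"
    proof (rule integral_dominated_convergence)
      \<comment> \<open>The derivative inherits measurability as a pointwise limit of difference
        quotients.\<close>
      show "(\<lambda>x. deriv (\<lambda>z. K z x) z0) \<in> borel_measurable M"
        using m lim by (rule borel_measurable_LIMSEQ_metric)
      show "integrable M (\<lambda>x. 4 * h x / r)" using h by simp
      show "AE x in M. (\<lambda>i. (K (X i) x - K z0 x) / (X i - z0)) \<longlonglongrightarrow> deriv (\<lambda>z. K z x) z0"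
        using lim by (rule AE_I2)
      show "AE x in M. norm ((K (X i) x - K z0 x) / (X i - z0)) \<le> 4 * h x / r" for i
        using X(1) by (intro AE_I2 lip) auto
    qed (rule m)
    then show "(\<lambda>i. ((\<integral>x. K (X i) x \<partial>M) - (\<integral>x. K z0 x \<partial>M)) / (X i - z0))
        \<longlonglongrightarrow> (\<integral>x. deriv (\<lambda>z. K z x) z0 \<partial>M)"
      by (simp add: Bochner_Integration.integral_diff int[OF Xr] int[OF z0r])
  qed
  then show ?thesis
    using r by (simp add: at_within_open[of z0 "ball z0 (r/2)"])
qed

section \<open>Geometry of products of balls\<close>

lemma block_norm_nonneg: "block_norm blk j z \<ge> 0"
  by (simp add: block_norm_def L2_set_nonneg)

lemma block_norm_triangle: "block_norm blk j (z + w) \<le> block_norm blk j z + block_norm blk j w"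
  unfolding block_norm_def
  by (rule order_trans[OF L2_set_mono L2_set_triangle_ineq]) (auto intro: norm_triangle_ineq)

lemma block_norm_scaleR: "block_norm blk j (r *\<^sub>R z) = \<bar>r\<bar> * block_norm blk j z"
  unfolding block_norm_def by (subst L2_set_right_distrib) auto

lemma block_norm_zero: "block_norm blk j 0 = 0"
  by (simp add: block_norm_def L2_set_def)

lemma zero_mem_ball_product: "0 \<in> ball_product blk"
  by (simp add: ball_product_def block_norm_zero)

lemma continuous_on_block_norm [continuous_intros]:
  "continuous_on S f \<Longrightarrow> continuous_on S (\<lambda>x. block_norm blk j (f x))"
  unfolding block_norm_def L2_set_def by (intro continuous_intros)

lemma continuous_on_block_inner [continuous_intros]:
  "continuous_on S f \<Longrightarrow> continuous_on S g \<Longrightarrow> continuous_on S (\<lambda>x. block_inner blk j (f x) (g x))"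
  unfolding block_inner_def by (intro continuous_intros)

lemma open_ball_product: "open (ball_product blk)"
proof -
  have "ball_product blk = (\<Inter>j. {z. block_norm blk j z < 1})"
    by (auto simp: ball_product_def)
  moreover have "open {z. block_norm blk j z < 1}" for j
    by (intro open_Collect_less continuous_intros)
  ultimately show ?thesis by (simp add: open_INT)
qed

lemma convex_ball_product: "convex (ball_product blk)"
proof (rule convexI)
  fix x y and u v :: real
  assume xy: "x \<in> ball_product blk" "y \<in> ball_product blk" and uv: "0 \<le> u" "0 \<le> v" "u + v = 1"
  show "u *\<^sub>R x + v *\<^sub>R y \<in> ball_product blk"
    unfolding ball_product_def
  proof (intro CollectI allI)
    fix j
    have "block_norm blk j (u *\<^sub>R x + v *\<^sub>R y) \<le> u * block_norm blk j x + v * block_norm blk j y"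
      using block_norm_triangle[of blk j "u *\<^sub>R x" "v *\<^sub>R y"] uv by (simp add: block_norm_scaleR)
    also have "\<dots> < 1"
      using xy uv by (intro convex_bound_lt) (auto simp: ball_product_def)
    finally show "block_norm blk j (u *\<^sub>R x + v *\<^sub>R y) < 1" .
  qed
qed

lemma norm_component_le:
  assumes "\<zeta> \<in> dist_boundary blk" shows "norm (\<zeta> $ i) \<le> 1"
  using member_le_L2_set[of "blk -` {blk i}" i "\<lambda>i. norm (\<zeta> $ i)"] assms
  by (auto simp: dist_boundary_def block_norm_def)

lemma cnj_block_inner: "cnj (block_inner blk j z w) = block_inner blk j w z"
  by (simp add: block_inner_def mult.commute)

lemma norm_block_inner_le: "norm (block_inner blk j z w) \<le> block_norm blk j z * block_norm blk j w"
proof -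
  have "norm (block_inner blk j z w) \<le> (\<Sum>i\<in>blk -` {j}. \<bar>norm (z $ i)\<bar> * \<bar>norm (w $ i)\<bar>)"
    unfolding block_inner_def by (rule order_trans[OF norm_sum]) (simp add: norm_mult)
  also have "\<dots> \<le> block_norm blk j z * block_norm blk j w"
    unfolding block_norm_def by (rule L2_set_mult_ineq)
  finally show ?thesis .
qed

lemma block_inner_ne_1:
  assumes "z \<in> ball_product blk" "w \<in> ball_product blk \<union> dist_boundary blk"
  shows "1 - block_inner blk j z w \<noteq> 0"
proof -
  have "norm (block_inner blk j z w) \<le> block_norm blk j z * block_norm blk j w"
    by (rule norm_block_inner_le)
  also have "\<dots> \<le> block_norm blk j z"
    using assms(2) block_norm_nonneg[of blk j z]
    by (intro mult_left_le) (auto simp: ball_product_def dist_boundary_def less_imp_le)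
  also have "\<dots> < 1" using assms(1) by (simp add: ball_product_def)
  finally show ?thesis by auto
qed

text \<open>Arbitrary exponents make the family closed under differentiation in \<open>z\<close>.\<close>

definition power_kernel ::
    "('n::finite \<Rightarrow> 'k::finite) \<Rightarrow> ('k \<Rightarrow> nat) \<Rightarrow> complex ^ 'n \<Rightarrow> complex ^ 'n \<Rightarrow> complex" where
  "power_kernel blk m z w = (\<Prod>j\<in>UNIV. 1 / (1 - block_inner blk j z w) ^ m j)"

text \<open>A majorant of the kernel over the whole distinguished boundary. It depends continuously
  on \<open>z\<close> alone, so on compact sets it yields the constants needed for differentiation
  under the integral.\<close>

definition power_kernel_bound ::
    "('n::finite \<Rightarrow> 'k::finite) \<Rightarrow> ('k \<Rightarrow> nat) \<Rightarrow> complex ^ 'n \<Rightarrow> real" where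
  "power_kernel_bound blk m z = (\<Prod>j\<in>UNIV. 1 / (1 - block_norm blk j z) ^ m j)"

lemma cauchy_kernel_eq: "cauchy_kernel blk = power_kernel blk (\<lambda>j. card (blk -` {j}))"
  by (simp add: fun_eq_iff cauchy_kernel_def power_kernel_def)

lemma cnj_cauchy_kernel: "cnj (cauchy_kernel blk z w) = cauchy_kernel blk w z"
  by (simp add: cauchy_kernel_def cnj_block_inner)

lemma norm_cauchy_kernel_commute: "norm (cauchy_kernel blk z w) = norm (cauchy_kernel blk w z)"
  by (metis cnj_cauchy_kernel complex_mod_cnj)

lemma norm_power_kernel_le:
  assumes "z \<in> ball_product blk" "\<zeta> \<in> dist_boundary blk"
  shows "norm (power_kernel blk m z \<zeta>) \<le> power_kernel_bound blk m z"
proof -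
  have "1 / norm (1 - block_inner blk j z \<zeta>) ^ m j \<le> 1 / (1 - block_norm blk j z) ^ m j" for j
  proof (intro divide_left_mono power_mono mult_pos_pos zero_less_power)
    have "norm (block_inner blk j z \<zeta>) \<le> block_norm blk j z"
      using norm_block_inner_le[of blk j z \<zeta>] assms(2) by (simp add: dist_boundary_def)
    then show "1 - block_norm blk j z \<le> norm (1 - block_inner blk j z \<zeta>)"
      using norm_triangle_ineq2[of 1 "block_inner blk j z \<zeta>"] by simp
    show "0 < 1 - block_norm blk j z" "0 \<le> 1 - block_norm blk j z"
      using assms(1) by (auto simp: ball_product_def less_imp_le)
    show "0 < norm (1 - block_inner blk j z \<zeta>)"
      using block_inner_ne_1[of z blk \<zeta> j] assms by simp
  qed simp
  then show ?thesis
    unfolding power_kernel_def power_kernel_bound_def prod_norm[symmetric]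
    by (intro prod_mono) (simp add: norm_divide norm_power)
qed

lemma continuous_on_power_kernel_bound:
  assumes "continuous_on S f" "f ` S \<subseteq> ball_product blk"
  shows "continuous_on S (\<lambda>x. power_kernel_bound blk m (f x))"
proof -
  have "1 - block_norm blk j (f x) \<noteq> 0" if "x \<in> S" for j x
  proof -
    have "block_norm blk j (f x) < 1"
      using assms(2) that by (auto simp: ball_product_def)
    then show ?thesis by simp
  qed
  then show ?thesis
    unfolding power_kernel_bound_def using assms(1)
    by (intro continuous_intros) simp_all
qed

lemma power_kernel_bounded_near:
  fixes f :: "complex \<Rightarrow> complex ^ 'n"
  assumes S: "continuous_on S f" "f ` S \<subseteq> ball_product blk" "cball z0 r \<subseteq> S"
  obtains C where "\<And>z \<zeta>. z \<in> cball z0 r \<Longrightarrow> \<zeta> \<in> dist_boundary blk \<Longrightarrow>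
    norm (power_kernel blk m (f z) \<zeta>) \<le> C"
proof -
  have cont: "continuous_on (cball z0 r) f" and img: "f ` cball z0 r \<subseteq> ball_product blk"
    using continuous_on_subset[OF S(1,3)] S(2,3) by auto
  have "bounded ((\<lambda>z. power_kernel_bound blk m (f z)) ` cball z0 r)"
    using continuous_on_power_kernel_bound[OF cont img] compact_continuous_image compact_cball
      compact_imp_bounded by blast
  then obtain C where C: "\<And>z. z \<in> cball z0 r \<Longrightarrow> norm (power_kernel_bound blk m (f z)) \<le> C"
    unfolding bounded_iff by blast
  show ?thesis
  proof (rule that[of C])
    fix z \<zeta> assume z: "z \<in> cball z0 r" and \<zeta>: "\<zeta> \<in> dist_boundary blk"
    have "norm (power_kernel blk m (f z) \<zeta>) \<le> power_kernel_bound blk m (f z)"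
      using img z \<zeta> by (intro norm_power_kernel_le) auto
    then show "norm (power_kernel blk m (f z) \<zeta>) \<le> C" using C[OF z] by simp
  qed
qed

lemma continuous_on_power_kernel:
  assumes "continuous_on S f" "continuous_on S g"
    and "\<And>x. x \<in> S \<Longrightarrow> f x \<in> ball_product blk"
    and "\<And>x. x \<in> S \<Longrightarrow> g x \<in> ball_product blk \<union> dist_boundary blk"
  shows "continuous_on S (\<lambda>x. power_kernel blk m (f x) (g x))"
  unfolding power_kernel_def using assms(1,2) block_inner_ne_1[OF assms(3,4)]
  by (intro continuous_intros) auto

text \<open>The second argument enters only through conjugated coordinates, which is why the
  hypothesis on \<open>g\<close> concerns those.\<close>

lemma holomorphic_on_power_kernel:
  fixes f g :: "complex \<Rightarrow> complex ^ 'n"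
  assumes f: "\<And>l. (\<lambda>x. f x $ l) holomorphic_on S"
    and g: "\<And>l. (\<lambda>x. cnj (g x $ l)) holomorphic_on S"
    and mem: "\<And>x. x \<in> S \<Longrightarrow> f x \<in> ball_product blk"
      "\<And>x. x \<in> S \<Longrightarrow> g x \<in> ball_product blk \<union> dist_boundary blk"
  shows "(\<lambda>x. power_kernel blk m (f x) (g x)) holomorphic_on S"
proof -
  have "(\<lambda>x. block_inner blk j (f x) (g x)) holomorphic_on S" for j
    unfolding block_inner_def by (intro holomorphic_intros f g)
  then show ?thesis
    unfolding power_kernel_def using block_inner_ne_1[OF mem]
    by (intro holomorphic_intros) auto
qed

text \<open>By the chain rule the real derivative is \<open>h \<mapsto> f' ((c * h) *s d)\<close>;
  complex linearity of \<open>f'\<close> makes it multiplication by \<open>c * f' d\<close>.\<close>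

lemma holomorphic_sv_along_line:
  assumes "holomorphic_sv f D"
  shows "(\<lambda>x. f (p + (c * x) *s d)) holomorphic_on {x. p + (c * x) *s d \<in> D}"
  unfolding holomorphic_on_def
proof (rule ballI)
  fix x assume "x \<in> {x. p + (c * x) *s d \<in> D}"
  then obtain f' where f': "(f has_derivative f') (at (p + (c * x) *s d))"
      "\<And>c v. f' (c *s v) = c * f' v"
    using assms by (auto simp: holomorphic_sv_def)
  have "linear (\<lambda>h. (c * h) *s d)"
    by (rule linearI) (simp_all add: vec_eq_iff scaleR_conv_of_real[where 'a = complex] algebra_simps)
  then have vec: "((\<lambda>x. p + (c * x) *s d) has_derivative (\<lambda>h. (c * h) *s d)) (at x)"
    using has_derivative_add[OF has_derivative_const bounded_linear_imp_has_derivative]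
    by (fastforce simp: linear_conv_bounded_linear)
  have "((\<lambda>x. f (p + (c * x) *s d)) has_derivative (\<lambda>h. f' ((c * h) *s d))) (at x)"
    by (rule has_derivative_compose[OF vec f'(1)])
  moreover have "(\<lambda>h. f' ((c * h) *s d)) = (*) (c * f' d)"
    by (auto simp: f'(2))
  ultimately have "((\<lambda>x. f (p + (c * x) *s d)) has_field_derivative (c * f' d)) (at x)"
    by (simp add: has_field_derivative_def)
  then show "(\<lambda>x. f (p + (c * x) *s d)) field_differentiable (at x within {x. p + (c * x) *s d \<in> D})"
    using field_differentiable_at_within field_differentiable_def by blast
qed

lemma continuous_on_line:
  fixes p d :: "complex ^ 'n"
  shows "continuous_on S f \<Longrightarrow> continuous_on S (\<lambda>x. p + f x *s d)"
  unfolding vector_scalar_mult_def by (intro continuous_intros)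

section \<open>Finite measures on the distinguished boundary\<close>

locale finite_boundary_measure = finite_measure \<sigma>
  for \<sigma> :: "(complex ^ 'n::finite) measure" +
  fixes blk :: "'n \<Rightarrow> 'k::finite"
  assumes sets_boundary: "sets \<sigma> = sets (restrict_space borel (dist_boundary blk))"
begin

lemma space_boundary: "space \<sigma> = dist_boundary blk"
  using sets_eq_imp_space_eq[OF sets_boundary] by (simp add: space_restrict_space)

lemma measurable_continuous:
  fixes f :: "complex ^ 'n \<Rightarrow> complex"
  assumes "continuous_on (dist_boundary blk) f"
  shows "f \<in> borel_measurable \<sigma>"
  using borel_measurable_continuous_on_restrict[OF assms]
  by (simp add: measurable_cong_sets[OF sets_boundary refl])

lemma power_kernel_measurable:
  "z \<in> ball_product blk \<Longrightarrow> power_kernel blk m z \<in> borel_measurable \<sigma>"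
  using continuous_on_power_kernel[of "dist_boundary blk" "\<lambda>_. z" "\<lambda>\<zeta>. \<zeta>" blk m]
  by (intro measurable_continuous) (auto intro: continuous_intros)

lemma cauchy_kernel_measurable:
  assumes "z \<in> ball_product blk"
  shows "(\<lambda>\<zeta>. cauchy_kernel blk z \<zeta>) \<in> borel_measurable \<sigma>"
    and "(\<lambda>\<zeta>. cauchy_kernel blk \<zeta> z) \<in> borel_measurable \<sigma>"
proof -
  show *: "(\<lambda>\<zeta>. cauchy_kernel blk z \<zeta>) \<in> borel_measurable \<sigma>"
    using power_kernel_measurable[OF assms] by (simp add: cauchy_kernel_eq)
  have "(\<lambda>\<zeta>. cnj (cauchy_kernel blk z \<zeta>)) \<in> borel_measurable \<sigma>"
    by (rule borel_measurable_continuous_on[OF _ *]) (auto intro: continuous_intros)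
  then show "(\<lambda>\<zeta>. cauchy_kernel blk \<zeta> z) \<in> borel_measurable \<sigma>"
    by (simp add: cnj_cauchy_kernel)
qed

lemma cauchy_kernel_L2:
  assumes "w \<in> ball_product blk"
  shows "(\<lambda>\<zeta>. cauchy_kernel blk \<zeta> w) \<in> L2_space \<sigma>"
proof (rule bounded_mem_L2[OF finite_measure_axioms cauchy_kernel_measurable(2)[OF assms]])
  fix \<zeta> assume "\<zeta> \<in> space \<sigma>"
  then show "norm (cauchy_kernel blk \<zeta> w) \<le> power_kernel_bound blk (\<lambda>j. card (blk -` {j})) w"
    using norm_power_kernel_le[OF assms, of \<zeta>]
    unfolding norm_cauchy_kernel_commute[of blk \<zeta>] by (simp add: space_boundary cauchy_kernel_eq)
qed

text \<open>On a small closed disc both kernels are bounded uniformly in the boundary variable, so a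
  constant dominates the integrand; it is integrable because the measure is finite.\<close>

lemma holomorphic_kernel_integral:
  fixes f g :: "complex \<Rightarrow> complex ^ 'n"
  assumes f: "\<And>l. (\<lambda>x. f x $ l) holomorphic_on S"
    and g: "\<And>l. (\<lambda>x. cnj (g x $ l)) holomorphic_on S"
    and cont: "continuous_on S f" "continuous_on S g"
    and mem: "f ` S \<subseteq> ball_product blk" "g ` S \<subseteq> ball_product blk"
    and S: "open S"
  shows "(\<lambda>x. \<integral>\<zeta>. cauchy_kernel blk (f x) \<zeta> * cauchy_kernel blk \<zeta> (g x) \<partial>\<sigma>) holomorphic_on S"
  unfolding holomorphic_on_def
proof
  fix x0 assume "x0 \<in> S"
  then obtain r where r: "r > 0" "cball x0 r \<subseteq> S"
    using S open_contains_cball by blast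
  let ?n = "\<lambda>j. card (blk -` {j})"
  obtain C where C: "\<And>z \<zeta>. z \<in> cball x0 r \<Longrightarrow> \<zeta> \<in> dist_boundary blk \<Longrightarrow>
      norm (power_kernel blk ?n (f z) \<zeta>) \<le> C"
    using power_kernel_bounded_near[OF cont(1) mem(1) r(2), of ?n] by blast
  obtain C' where C': "\<And>z \<zeta>. z \<in> cball x0 r \<Longrightarrow> \<zeta> \<in> dist_boundary blk \<Longrightarrow>
      norm (power_kernel blk ?n (g z) \<zeta>) \<le> C'"
    using power_kernel_bounded_near[OF cont(2) mem(2) r(2), of ?n] by blast
  have sub: "ball x0 r \<subseteq> S" using r(2) ball_subset_cball by blast
  have cb: "x \<in> cball x0 r" if "x \<in> ball x0 r" for x using that ball_subset_cball by blast
  have fD: "f x \<in> ball_product blk" and gD: "g x \<in> ball_product blk" if "x \<in> ball x0 r" for x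
    using subsetD[OF sub that] mem by auto
  let ?K = "\<lambda>x \<zeta>. cauchy_kernel blk (f x) \<zeta> * cauchy_kernel blk \<zeta> (g x)"
  have "((\<lambda>x. \<integral>\<zeta>. ?K x \<zeta> \<partial>\<sigma>) has_field_derivative (\<integral>\<zeta>. deriv (\<lambda>x. ?K x \<zeta>) x0 \<partial>\<sigma>)) (at x0)"
  proof (rule has_field_derivative_integral_dominated[OF r(1)])
    show "?K x \<in> borel_measurable \<sigma>" if "x \<in> ball x0 r" for x
      using that by (intro borel_measurable_times cauchy_kernel_measurable fD gD)
    show "(\<lambda>x. ?K x \<zeta>) holomorphic_on ball x0 r" if \<zeta>: "\<zeta> \<in> space \<sigma>" for \<zeta>
    proof (intro holomorphic_on_mult)
      show "(\<lambda>x. cauchy_kernel blk (f x) \<zeta>) holomorphic_on ball x0 r"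
        unfolding cauchy_kernel_eq using \<zeta> fD
        by (intro holomorphic_on_power_kernel holomorphic_on_subset[OF f sub] holomorphic_intros)
          (auto simp: space_boundary)
      \<comment> \<open>Here the boundary point stands first, whereas
        \<open>holomorphic_on_power_kernel\<close> wants a point of the ball product there. The
        denominators are nonzero by conjugation symmetry.\<close>
      have "(\<lambda>x. cauchy_kernel blk \<zeta> (g x)) = (\<lambda>x. \<Prod>j\<in>UNIV. 1 / (1 - block_inner blk j \<zeta> (g x)) ^ ?n j)"
        by (simp add: cauchy_kernel_def)
      moreover have "(\<lambda>x. block_inner blk j \<zeta> (g x)) holomorphic_on ball x0 r" for j
        unfolding block_inner_def
        by (intro holomorphic_intros holomorphic_on_subset[OF g sub])
      moreover have "1 - block_inner blk j \<zeta> (g x) \<noteq> 0" if "x \<in> ball x0 r" for x j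
      proof -
        have "1 - block_inner blk j (g x) \<zeta> \<noteq> 0"
          using that \<zeta> gD by (intro block_inner_ne_1) (auto simp: space_boundary)
        then have "cnj (1 - block_inner blk j (g x) \<zeta>) \<noteq> 0" by (simp only: complex_cnj_zero_iff not_False_eq_True)
        then show ?thesis by (simp add: cnj_block_inner)
      qed
      ultimately show "(\<lambda>x. cauchy_kernel blk \<zeta> (g x)) holomorphic_on ball x0 r"
        by (auto intro!: holomorphic_intros)
    qed
    show "norm (?K x \<zeta>) \<le> C * C'" if "x \<in> ball x0 r" "\<zeta> \<in> space \<sigma>" for x \<zeta>
    proof -
      have "norm (cauchy_kernel blk (f x) \<zeta>) \<le> C"
        using C[OF cb[OF that(1)]] that(2) by (simp add: space_boundary cauchy_kernel_eq)
      moreover have "norm (cauchy_kernel blk \<zeta> (g x)) \<le> C'"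
        using C'[OF cb[OF that(1)]] that(2)
        unfolding norm_cauchy_kernel_commute[of blk \<zeta>] by (simp add: space_boundary cauchy_kernel_eq)
      ultimately show ?thesis
        unfolding norm_mult by (intro mult_mono order_trans[OF norm_ge_zero]) auto
    qed
  qed simp
  then show "(\<lambda>x. \<integral>\<zeta>. ?K x \<zeta> \<partial>\<sigma>) field_differentiable (at x0 within S)"
    using field_differentiable_at_within field_differentiable_def by blast
qed

end

section \<open>The Clark measure identity\<close>

text \<open>As \<open>\<alpha>\<close> is unimodular, the first two factors multiply to the squared
  modulus of \<open>\<alpha> - b z\<close>. The claim is the defining Poisson identity with its
  denominators cleared.\<close>

lemma clark_identity_diagonal:
  fixes blk :: "'n::finite \<Rightarrow> 'k::finite"
  assumes clark: "clark_measure blk b \<alpha> \<sigma>" and \<alpha>: "norm \<alpha> = 1"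
    and z: "z \<in> ball_product blk" and b: "norm (b z) < 1"
  shows "(1 - cnj \<alpha> * b z) * (1 - \<alpha> * cnj (b z)) *
      (\<integral>\<zeta>. cauchy_kernel blk z \<zeta> * cauchy_kernel blk \<zeta> z \<partial>\<sigma>) = dbr_kernel blk b z z"
proof -
  have C: "cauchy_kernel blk z z \<noteq> 0"
    using block_inner_ne_1[of z blk z] z by (simp add: cauchy_kernel_def)
  have "\<alpha> * cnj \<alpha> = 1"
    using \<alpha> by (simp add: complex_norm_square[symmetric])
  then have "(1 - cnj \<alpha> * b z) * (1 - \<alpha> * cnj (b z)) = (\<alpha> - b z) * cnj (\<alpha> - b z)"
    by (simp add: algebra_simps)
  also have "\<dots> = of_real ((norm (\<alpha> - b z))\<^sup>2)"
    by (rule complex_norm_square[symmetric])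
  finally have eq: "(1 - cnj \<alpha> * b z) * (1 - \<alpha> * cnj (b z)) = of_real ((norm (\<alpha> - b z))\<^sup>2)" .
  have ne: "norm (\<alpha> - b z) \<noteq> 0" using \<alpha> b by auto
  have "(\<integral>\<zeta>. poisson_kernel blk z \<zeta> \<partial>\<sigma>)
      = (\<integral>\<zeta>. cauchy_kernel blk z \<zeta> * cauchy_kernel blk \<zeta> z \<partial>\<sigma>) / cauchy_kernel blk z z"
    unfolding poisson_kernel_def by (rule integral_divide_zero)
  moreover have "(\<integral>\<zeta>. poisson_kernel blk z \<zeta> \<partial>\<sigma>)
      = of_real ((1 - (norm (b z))\<^sup>2) / (norm (\<alpha> - b z))\<^sup>2)"
    using clark z by (simp add: clark_measure_def)
  ultimately have "(\<integral>\<zeta>. cauchy_kernel blk z \<zeta> * cauchy_kernel blk \<zeta> z \<partial>\<sigma>)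
      = of_real ((1 - (norm (b z))\<^sup>2) / (norm (\<alpha> - b z))\<^sup>2) * cauchy_kernel blk z z"
    using C by (simp add: field_simps)
  then show ?thesis
    unfolding eq dbr_kernel_def using ne
    by (simp add: complex_norm_square[symmetric])
qed

text \<open>
  Both sides are holomorphic in \<open>z\<close> and antiholomorphic in \<open>w\<close>, and they agree for \<open>z = w\<close>.
  The points \<open>P x\<close>, \<open>Q x\<close> below agree for real \<open>x\<close>, whereas \<open>P (\<i>/2) = z\<close> and \<open>Q (\<i>/2) = w\<close>; the
  difference of the two sides at \<open>(P x, Q x)\<close> is holomorphic in the single variable \<open>x\<close>.
\<close>

lemma clark_identity:
  fixes blk :: "'n::finite \<Rightarrow> 'k::finite"
  assumes clark: "clark_measure blk b \<alpha> \<sigma>" and \<alpha>: "norm \<alpha> = 1"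
    and hol: "holomorphic_sv b (ball_product blk)"
    and b: "b ` ball_product blk \<subseteq> ball 0 1"
    and z: "z \<in> ball_product blk" and w: "w \<in> ball_product blk"
  shows "(1 - cnj \<alpha> * b z) * (1 - \<alpha> * cnj (b w)) *
      (\<integral>\<zeta>. cauchy_kernel blk z \<zeta> * cauchy_kernel blk \<zeta> w \<partial>\<sigma>) = dbr_kernel blk b z w"
proof -
  interpret finite_measure \<sigma> using clark by (simp add: clark_measure_def)
  interpret finite_boundary_measure \<sigma> blk
    using clark by unfold_locales (simp add: clark_measure_def)
  let ?D = "ball_product blk"
  \<comment> \<open>With \<open>p\<close> the midpoint and \<open>d = w - z\<close>, the parameter
    \<open>\<i>/2\<close> gives \<open>p - d/2 = z\<close> in \<open>P\<close> and
    \<open>p + d/2 = w\<close> in \<open>Q\<close>. The conjugate in \<open>Q\<close> makes its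
    conjugated coordinates holomorphic in \<open>x\<close>.\<close>
  define p where "p = (1/2) *\<^sub>R z + (1/2) *\<^sub>R w"
  define d where "d = w - z"
  define P where "P x = p + (\<i> * x) *s d" for x
  define Q where "Q x = p + (\<i> * cnj x) *s d" for x
  define S where "S = {x. P x \<in> ?D} \<inter> {x. Q x \<in> ?D}"
  have p: "p \<in> ?D"
    unfolding p_def using z w by (intro convexD[OF convex_ball_product]) auto
  have contP: "continuous_on A P" and contQ: "continuous_on A Q" for A
    unfolding P_def Q_def by (intro continuous_on_line continuous_intros)+
  have Pz: "P (\<i>/2) = z" and Qw: "Q (\<i>/2) = w"
    by (simp_all add: P_def Q_def p_def d_def vec_eq_iff scaleR_conv_of_real[where 'a = complex] field_simps)
  have openP: "open {x. P x \<in> ?D}" and openQ: "open {x. Q x \<in> ?D}"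
    using open_vimage[OF open_ball_product contP[of UNIV]] open_vimage[OF open_ball_product contQ[of UNIV]]
    by (simp_all add: vimage_def)
  then have "open S" by (simp add: S_def open_Int)
  \<comment> \<open>Convexity supplies the connectedness that the identity theorem requires.\<close>
  have "convex S"
  proof (rule convexI)
    fix x y and u v :: real assume xy: "x \<in> S" "y \<in> S" and uv: "0 \<le> u" "0 \<le> v" "u + v = 1"
    have u: "u = 1 - v" using uv by simp
    have "P (u *\<^sub>R x + v *\<^sub>R y) = u *\<^sub>R P x + v *\<^sub>R P y" "Q (u *\<^sub>R x + v *\<^sub>R y) = u *\<^sub>R Q x + v *\<^sub>R Q y"
      unfolding u by (simp_all add: P_def Q_def vec_eq_iff scaleR_conv_of_real[where 'a = complex] algebra_simps)
    then show "u *\<^sub>R x + v *\<^sub>R y \<in> S"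
      using xy uv convexD[OF convex_ball_product] by (auto simp: S_def)
  qed
  define G where "G x = (1 - cnj \<alpha> * b (P x)) * (1 - \<alpha> * cnj (b (Q x))) *
      (\<integral>\<zeta>. cauchy_kernel blk (P x) \<zeta> * cauchy_kernel blk \<zeta> (Q x) \<partial>\<sigma>) - dbr_kernel blk b (P x) (Q x)" for x
  have holP: "(\<lambda>x. P x $ l) holomorphic_on A" for l A
    unfolding P_def by (auto intro!: holomorphic_intros)
  have holQ: "(\<lambda>x. cnj (Q x $ l)) holomorphic_on A" for l A
    unfolding Q_def by (auto intro!: holomorphic_intros)
  have bP: "(\<lambda>x. b (P x)) holomorphic_on S"
    unfolding P_def using holomorphic_sv_along_line[OF hol, of p \<i> d]
    by (rule holomorphic_on_subset) (auto simp: S_def P_def)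
  \<comment> \<open>Schwarz reflection: the function is \<open>cnj \<circ> F \<circ> cnj\<close>
    with \<open>F\<close> the restriction of \<open>b\<close> to a complex line.\<close>
  have bQ: "(\<lambda>x. cnj (b (Q x))) holomorphic_on S"
  proof -
    have "cnj \<circ> (\<lambda>x. b (p + (\<i> * x) *s d)) \<circ> cnj holomorphic_on {x. Q x \<in> ?D}"
      by (intro holomorphic_on_compose_cnj_cnj openQ
          holomorphic_on_subset[OF holomorphic_sv_along_line[OF hol, of p \<i> d]])
        (auto simp: Q_def)
    then show ?thesis
      by (rule holomorphic_on_subset[THEN holomorphic_transform]) (auto simp: S_def Q_def)
  qed
  have holG: "G holomorphic_on S"
    unfolding G_def dbr_kernel_def cauchy_kernel_eq
  proof (intro holomorphic_intros bP bQ)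
    show "(\<lambda>x. power_kernel blk (\<lambda>j. card (blk -` {j})) (P x) (Q x)) holomorphic_on S"
      by (intro holomorphic_on_power_kernel holP holQ) (auto simp: S_def)
    show "(\<lambda>x. \<integral>\<zeta>. power_kernel blk (\<lambda>j. card (blk -` {j})) (P x) \<zeta> *
        power_kernel blk (\<lambda>j. card (blk -` {j})) \<zeta> (Q x) \<partial>\<sigma>) holomorphic_on S"
      unfolding cauchy_kernel_eq[symmetric]
      by (intro holomorphic_kernel_integral holP holQ contP contQ \<open>open S\<close>) (auto simp: S_def)
  qed
  have "0 \<in> S" using p by (simp add: S_def P_def Q_def)
  have "G (\<i>/2) = 0"
  proof (rule analytic_continuation[OF holG \<open>open S\<close> convex_connected[OF \<open>convex S\<close>]])
    show "S \<inter> \<real> \<subseteq> S" by blast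
    show "0 \<in> S" by fact
    show "(0::complex) islimpt S \<inter> \<real>"
      unfolding islimpt_approachable
    proof (intro allI impI)
      fix e :: real assume "e > 0"
      obtain r where r: "r > 0" "ball 0 r \<subseteq> S"
        using \<open>open S\<close> \<open>0 \<in> S\<close> open_contains_ball by blast
      let ?x = "complex_of_real (min r e / 2)"
      have n: "norm ?x < r" "norm ?x < e"
        unfolding norm_of_real using r(1) \<open>e > 0\<close> by (auto simp: min_def)
      moreover have "?x \<noteq> 0" using r(1) \<open>e > 0\<close> by (simp add: min_def)
      moreover have "?x \<in> S" using n(1) r(2) by (auto simp del: norm_of_real of_real_divide)
      ultimately show "\<exists>x'\<in>S \<inter> \<real>. x' \<noteq> 0 \<and> dist x' 0 < e"
        by (intro bexI[of _ ?x]) (auto simp del: norm_of_real of_real_divide)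
    qed
    show "\<i>/2 \<in> S" using z w by (simp add: S_def Pz Qw)
    show "G x = 0" if "x \<in> S \<inter> \<real>" for x
    proof -
      have "cnj x = x" using that by (simp add: Reals_cnj_iff)
      then have "Q x = P x" by (simp add: P_def Q_def)
      then show ?thesis
        using clark_identity_diagonal[OF clark \<alpha>, of "P x"] b that by (auto simp: G_def S_def)
    qed
  qed
  then show ?thesis by (simp add: G_def Pz Qw)
qed

section \<open>Moments\<close>

definition monomial :: "('n \<Rightarrow> nat) \<Rightarrow> complex ^ 'n::finite \<Rightarrow> complex" where
  "monomial \<beta> z = (\<Prod>i\<in>UNIV. z $ i ^ \<beta> i)"

lemma norm_monomial_le:
  assumes "\<zeta> \<in> dist_boundary blk" shows "norm (monomial \<beta> \<zeta>) \<le> 1"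
  unfolding monomial_def prod_norm[symmetric]
  by (intro prod_le_1) (auto simp: norm_power intro!: power_le_one norm_component_le[OF assms])

lemma continuous_on_monomial [continuous_intros]: "continuous_on S (monomial \<beta>)"
  unfolding monomial_def by (intro continuous_intros)

lemma monomial_Suc:
  "monomial (\<beta>(i := Suc (\<beta> i))) z = z $ i * monomial \<beta> z"
proof -
  have "monomial (\<beta>(i := Suc (\<beta> i))) z = (\<Prod>l\<in>UNIV. (if l = i then z $ l else 1) * z $ l ^ \<beta> l)"
    unfolding monomial_def by (intro prod.cong) auto
  then show ?thesis by (simp add: prod.distrib monomial_def)
qed

lemma block_inner_axis:
  "block_inner blk j (w + x *s axis i 1) \<zeta> =
     block_inner blk j w \<zeta> + (if j = blk i then x * cnj (\<zeta> $ i) else 0)"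
proof -
  have "block_inner blk j (w + x *s axis i 1) \<zeta> =
      block_inner blk j w \<zeta> + (\<Sum>l\<in>blk -` {j}. if l = i then x * cnj (\<zeta> $ i) else 0)"
    unfolding block_inner_def sum.distrib[symmetric]
    by (intro sum.cong) (auto simp: axis_def algebra_simps)
  then show ?thesis by auto
qed

text \<open>Only the factor of the block containing \<open>i\<close> depends on \<open>x\<close>,
  and its denominator is a power of an affine function of \<open>x\<close>.\<close>

lemma has_field_derivative_power_kernel_axis:
  assumes w: "w + x *s axis i 1 \<in> ball_product blk" and \<zeta>: "\<zeta> \<in> dist_boundary blk"
  shows "((\<lambda>x. power_kernel blk m (w + x *s axis i 1) \<zeta>) has_field_derivative
    of_nat (m (blk i)) * cnj (\<zeta> $ i) *
      power_kernel blk (m(blk i := Suc (m (blk i)))) (w + x *s axis i 1) \<zeta>) (at x)"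
proof -
  define j0 where "j0 = blk i"
  define R where "R = (\<Prod>j\<in>UNIV - {j0}. 1 / (1 - block_inner blk j w \<zeta>) ^ m j)"
  define A where "A y = 1 - (block_inner blk j0 w \<zeta> + y * cnj (\<zeta> $ i))" for y
  have split: "power_kernel blk m' (w + y *s axis i 1) \<zeta> = 1 / A y ^ m' j0 * R"
    if "\<And>j. j \<noteq> j0 \<Longrightarrow> m' j = m j" for m' y
    unfolding power_kernel_def R_def
    by (subst prod.remove[of UNIV j0]) (auto simp: block_inner_axis j0_def A_def that[unfolded j0_def])
  have A: "A x \<noteq> 0"
    using block_inner_ne_1[OF w, of \<zeta> j0] \<zeta> by (simp add: block_inner_axis A_def j0_def)
  have "(A has_field_derivative - cnj (\<zeta> $ i)) (at x)"
    unfolding A_def by (auto intro!: derivative_eq_intros)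
  from DERIV_power[OF this, of "m j0"]
  have "((\<lambda>y. A y ^ m j0) has_field_derivative
      of_nat (m j0) * (- cnj (\<zeta> $ i) * A x ^ (m j0 - Suc 0))) (at x)" .
  then have "((\<lambda>y. inverse (A y ^ m j0) * R) has_field_derivative
      of_nat (m j0) * cnj (\<zeta> $ i) * (1 / A x ^ Suc (m j0) * R)) (at x)"
  proof (rule DERIV_cong[OF DERIV_cmult_right[OF DERIV_inverse_fun]])
    show "A x ^ m j0 \<noteq> 0" using A by simp
    \<comment> \<open>The exponent 0 is a separate case because \<open>m j0 - Suc 0\<close> is
      truncated; both sides are then 0.\<close>
    show "- (of_nat (m j0) * (- cnj (\<zeta> $ i) * A x ^ (m j0 - Suc 0)) * inverse ((A x ^ m j0) ^ Suc (Suc 0))) * R =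
        of_nat (m j0) * cnj (\<zeta> $ i) * (1 / A x ^ Suc (m j0) * R)"
      using A by (cases "m j0") (simp_all add: field_simps)
  qed
  then show ?thesis
    by (simp add: split j0_def[symmetric] inverse_eq_divide)
qed

section \<open>Functions orthogonal to all Cauchy kernels\<close>

context finite_boundary_measure
begin

lemma cnj_monomial_measurable: "(\<lambda>\<zeta>. cnj (monomial \<beta> \<zeta>)) \<in> borel_measurable \<sigma>"
  by (intro measurable_continuous continuous_intros)

lemma integrable_mult_cnj_monomial:
  assumes "integrable \<sigma> g"
  shows "integrable \<sigma> (\<lambda>\<zeta>. g \<zeta> * cnj (monomial \<beta> \<zeta>))"
proof (rule Bochner_Integration.integrable_bound[OF assms])
  show "(\<lambda>\<zeta>. g \<zeta> * cnj (monomial \<beta> \<zeta>)) \<in> borel_measurable \<sigma>"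
    using assms cnj_monomial_measurable by (intro borel_measurable_times) auto
  show "AE \<zeta> in \<sigma>. norm (g \<zeta> * cnj (monomial \<beta> \<zeta>)) \<le> norm (g \<zeta>)"
    using norm_monomial_le[of _ blk]
    by (intro AE_I2) (auto simp: norm_mult space_boundary intro: mult_left_le)
qed

text \<open>An identically vanishing function of \<open>w\<close> is differentiated along the
  \<open>i\<close>-th axis, and the nonzero factor \<open>m (blk i)\<close> is divided out. The
  conclusion has the form of the hypothesis with a conjugate coordinate absorbed into
  \<open>g\<close>, so the step can be iterated.\<close>

lemma annihilator_step:
  fixes g :: "complex ^ 'n \<Rightarrow> complex"
  assumes g: "integrable \<sigma> g" and m: "m (blk i) > 0"
    and zero: "\<And>w. w \<in> ball_product blk \<Longrightarrow> (\<integral>\<zeta>. g \<zeta> * power_kernel blk m w \<zeta> \<partial>\<sigma>) = 0"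
    and w: "w \<in> ball_product blk"
  shows "(\<integral>\<zeta>. g \<zeta> * cnj (\<zeta> $ i) * power_kernel blk (m(blk i := Suc (m (blk i)))) w \<zeta> \<partial>\<sigma>) = 0"
proof -
  let ?P = "\<lambda>x. w + x *s axis i 1" and ?m' = "m(blk i := Suc (m (blk i)))"
  let ?K = "\<lambda>x \<zeta>. g \<zeta> * power_kernel blk m (?P x) \<zeta>"
  have contP: "continuous_on UNIV ?P" by (intro continuous_on_line continuous_intros)
  let ?S = "?P -` ball_product blk"
  have S: "open ?S" by (rule open_vimage[OF open_ball_product contP])
  moreover have "0 \<in> ?S" using w by simp
  ultimately obtain r where r: "r > 0" "cball 0 r \<subseteq> ?S"
    using open_contains_cball by blast
  obtain C where C: "\<And>x \<zeta>. x \<in> cball 0 r \<Longrightarrow> \<zeta> \<in> dist_boundary blk \<Longrightarrow>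
      norm (power_kernel blk m (?P x) \<zeta>) \<le> C"
    using power_kernel_bounded_near[OF continuous_on_subset[OF contP subset_UNIV] _ r(2)] by blast
  have mem: "?P x \<in> ball_product blk" if "x \<in> ball 0 r" for x
    using that r(2) ball_subset_cball by blast
  have "((\<lambda>x. \<integral>\<zeta>. ?K x \<zeta> \<partial>\<sigma>) has_field_derivative (\<integral>\<zeta>. deriv (\<lambda>x. ?K x \<zeta>) 0 \<partial>\<sigma>)) (at 0)"
  proof (rule has_field_derivative_integral_dominated[OF r(1)])
    show "?K x \<in> borel_measurable \<sigma>" if "x \<in> ball 0 r" for x
      using g power_kernel_measurable[OF mem[OF that]] by (intro borel_measurable_times) auto
    show "(\<lambda>x. ?K x \<zeta>) holomorphic_on ball 0 r" if "\<zeta> \<in> space \<sigma>" for \<zeta>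
    proof (intro holomorphic_on_mult holomorphic_on_const)
      show "(\<lambda>x. power_kernel blk m (?P x) \<zeta>) holomorphic_on ball 0 r"
        unfolding holomorphic_on_open[OF open_ball]
      proof (intro ballI exI)
        fix x :: complex assume "x \<in> ball 0 r"
        from has_field_derivative_power_kernel_axis[OF mem[OF this]] that
        show "((\<lambda>x. power_kernel blk m (?P x) \<zeta>) has_field_derivative
            of_nat (m (blk i)) * cnj (\<zeta> $ i) * power_kernel blk ?m' (?P x) \<zeta>) (at x)"
          by (simp add: space_boundary)
      qed
    qed
    show "norm (?K x \<zeta>) \<le> norm (g \<zeta>) * C" if "x \<in> ball 0 r" "\<zeta> \<in> space \<sigma>" for x \<zeta>
      unfolding norm_mult using that ball_subset_cball
      by (intro mult_left_mono C) (auto simp: space_boundary)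
    show "integrable \<sigma> (\<lambda>\<zeta>. norm (g \<zeta>) * C)" using g by simp
  qed
  moreover have "((\<lambda>x. \<integral>\<zeta>. ?K x \<zeta> \<partial>\<sigma>) has_field_derivative 0) (at 0)"
    using mem r(1)
    by (intro has_field_derivative_transform_within_open[OF DERIV_const[of 0] open_ball[of 0 r]])
      (auto simp: zero)
  ultimately have "(\<integral>\<zeta>. deriv (\<lambda>x. ?K x \<zeta>) 0 \<partial>\<sigma>) = 0"
    by (rule DERIV_unique)
  moreover have "(\<integral>\<zeta>. deriv (\<lambda>x. ?K x \<zeta>) 0 \<partial>\<sigma>) =
      (\<integral>\<zeta>. of_nat (m (blk i)) * (g \<zeta> * cnj (\<zeta> $ i) * power_kernel blk ?m' w \<zeta>) \<partial>\<sigma>)"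
  proof (intro Bochner_Integration.integral_cong refl DERIV_imp_deriv)
    fix \<zeta> assume "\<zeta> \<in> space \<sigma>"
    then have "((\<lambda>x. power_kernel blk m (?P x) \<zeta>) has_field_derivative
        of_nat (m (blk i)) * cnj (\<zeta> $ i) * power_kernel blk ?m' (?P 0) \<zeta>) (at 0)"
      using w by (intro has_field_derivative_power_kernel_axis) (auto simp: space_boundary)
    from DERIV_cmult[OF this, of "g \<zeta>"]
    show "((\<lambda>x. ?K x \<zeta>) has_field_derivative
        of_nat (m (blk i)) * (g \<zeta> * cnj (\<zeta> $ i) * power_kernel blk ?m' w \<zeta>)) (at 0)"
      by (simp add: mult_ac)
  qed
  ultimately show ?thesis using m by simp
qed

text \<open>Differentiating the Cauchy kernel at \<open>w = 0\<close> produces a non-zero multiple of each monomial.\<close>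

lemma annihilator_monomials:
  fixes g :: "complex ^ 'n \<Rightarrow> complex"
  assumes surj: "surj blk" and g: "integrable \<sigma> g"
    and zero: "\<And>w. w \<in> ball_product blk \<Longrightarrow> (\<integral>\<zeta>. g \<zeta> * cauchy_kernel blk w \<zeta> \<partial>\<sigma>) = 0"
  shows "(\<integral>\<zeta>. g \<zeta> * cnj (monomial \<beta> \<zeta>) \<partial>\<sigma>) = 0"
proof -
  \<comment> \<open>The exponents grow along the induction and their exact values are irrelevant;
    only their positivity has to be carried, for the division in the next step.\<close>
  have "\<exists>m. (\<forall>j. m j > 0) \<and> (\<forall>w\<in>ball_product blk.
      (\<integral>\<zeta>. g \<zeta> * cnj (monomial \<beta> \<zeta>) * power_kernel blk m w \<zeta> \<partial>\<sigma>) = 0)"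
  proof (induction "\<Sum>i\<in>UNIV. \<beta> i" arbitrary: \<beta>)
    case 0
    then have "\<beta> i = 0" for i by simp
    \<comment> \<open>Surjectivity enters here: every block is nonempty, so the Cauchy kernel starts
      with positive exponents.\<close>
    moreover have "card (blk -` {j}) > 0" for j
    proof -
      obtain i where "blk i = j" using surj by (metis surj_def)
      then show ?thesis by (auto simp: card_gt_0_iff)
    qed
    ultimately show ?case
      using zero by (intro exI[of _ "\<lambda>j. card (blk -` {j})"]) (simp add: monomial_def cauchy_kernel_eq)
  next
    case (Suc n)
    then obtain i where i: "\<beta> i > 0"
      by (metis (mono_tags, lifting) gr0I nat.distinct(1) sum.neutral)
    define \<beta>' where "\<beta>' = \<beta>(i := \<beta> i - 1)"
    have \<beta>: "\<beta> = \<beta>'(i := Suc (\<beta>' i))" using i by (auto simp: \<beta>'_def)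
    have "(\<Sum>l\<in>UNIV. \<beta> l) = Suc (\<Sum>l\<in>UNIV. \<beta>' l)"
      using i by (simp add: \<beta>'_def sum.remove[of UNIV i])
    then obtain m where m: "\<And>j. m j > 0" "\<And>w. w \<in> ball_product blk \<Longrightarrow>
        (\<integral>\<zeta>. g \<zeta> * cnj (monomial \<beta>' \<zeta>) * power_kernel blk m w \<zeta> \<partial>\<sigma>) = 0"
      using Suc.hyps(1)[of \<beta>'] Suc.hyps(2) by auto
    have "(\<integral>\<zeta>. g \<zeta> * cnj (monomial \<beta> \<zeta>) *
        power_kernel blk (m(blk i := Suc (m (blk i)))) w \<zeta> \<partial>\<sigma>) = 0"
      if "w \<in> ball_product blk" for w
      using annihilator_step[OF integrable_mult_cnj_monomial[OF g] m(1,2) that]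
      by (subst \<beta>) (simp add: monomial_Suc mult_ac)
    with m(1) show ?case
      by (intro exI[of _ "m(blk i := Suc (m (blk i)))"]) auto
  qed
  then obtain m where "(\<integral>\<zeta>. g \<zeta> * cnj (monomial \<beta> \<zeta>) * power_kernel blk m 0 \<zeta> \<partial>\<sigma>) = 0"
    using zero_mem_ball_product by blast
  \<comment> \<open>At the origin every power kernel equals 1, whatever its exponents.\<close>
  then show ?thesis by (simp add: power_kernel_def block_inner_def)
qed

end

section \<open>Holomorphic polynomials and the space \<open>H\<^sup>2\<close>\<close>

lemma holomorphic_polynomialE:
  assumes "p \<in> holomorphic_polynomials"
  obtains B c where "finite B" "p = (\<lambda>z. \<Sum>\<beta>\<in>B. c \<beta> * monomial \<beta> z)"
  using assms unfolding holomorphic_polynomials_def monomial_def by blast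

text \<open>In the definition of polynomials each exponent occurs once. Collecting the terms with
  equal exponents allows repetitions, which sums and products produce.\<close>

lemma holomorphic_polynomialI:
  fixes \<beta> :: "'i \<Rightarrow> 'n::finite \<Rightarrow> nat"
  assumes "finite I"
  shows "(\<lambda>z. \<Sum>i\<in>I. c i * monomial (\<beta> i) z) \<in> holomorphic_polynomials"
proof -
  have eq: "(\<lambda>z. \<Sum>i\<in>I. c i * monomial (\<beta> i) z) =
      (\<lambda>z. \<Sum>\<gamma>\<in>\<beta> ` I. (\<Sum>i | i \<in> I \<and> \<beta> i = \<gamma>. c i) * monomial \<gamma> z)"
  proof
    fix z
    have "(\<Sum>i\<in>I. c i * monomial (\<beta> i) z) =
        (\<Sum>\<gamma>\<in>\<beta> ` I. \<Sum>i | i \<in> I \<and> \<beta> i = \<gamma>. c i * monomial (\<beta> i) z)"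
      by (rule sum.image_gen[OF assms])
    also have "\<dots> = (\<Sum>\<gamma>\<in>\<beta> ` I. (\<Sum>i | i \<in> I \<and> \<beta> i = \<gamma>. c i) * monomial \<gamma> z)"
      by (simp add: sum_distrib_right)
    finally show "(\<Sum>i\<in>I. c i * monomial (\<beta> i) z) = \<dots>" .
  qed
  show ?thesis
    unfolding eq holomorphic_polynomials_def monomial_def[symmetric]
    by (intro CollectI exI[of _ "\<beta> ` I"] exI[of _ "\<lambda>\<gamma>. \<Sum>i | i \<in> I \<and> \<beta> i = \<gamma>. c i"] conjI refl
        finite_imageI assms)
qed

lemma polynomial_lincomb:
  assumes "p \<in> holomorphic_polynomials" "q \<in> holomorphic_polynomials"
  shows "(\<lambda>z. a * p z + q z) \<in> holomorphic_polynomials"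
proof -
  obtain B c where p: "finite B" "p = (\<lambda>z. \<Sum>\<beta>\<in>B. c \<beta> * monomial \<beta> z)"
    using assms(1) by (rule holomorphic_polynomialE)
  obtain B' c' where q: "finite B'" "q = (\<lambda>z. \<Sum>\<beta>\<in>B'. c' \<beta> * monomial \<beta> z)"
    using assms(2) by (rule holomorphic_polynomialE)
  \<comment> \<open>The disjoint sum as index set keeps the terms of \<open>p\<close> and
    \<open>q\<close> apart even where their exponents coincide.\<close>
  have "(\<lambda>z. \<Sum>x\<in>B <+> B'. case_sum (\<lambda>\<beta>. a * c \<beta>) c' x * monomial (case_sum id id x) z)
      \<in> holomorphic_polynomials"
    using p(1) q(1) by (intro holomorphic_polynomialI) simp
  then show ?thesis
    using p(1) q(1) by (simp add: p(2) q(2) sum.Plus sum_distrib_left mult.assoc)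
qed

lemma polynomial_mult:
  assumes "p \<in> holomorphic_polynomials" "q \<in> holomorphic_polynomials"
  shows "(\<lambda>z. p z * q z) \<in> holomorphic_polynomials"
proof -
  obtain B c where p: "finite B" "p = (\<lambda>z. \<Sum>\<beta>\<in>B. c \<beta> * monomial \<beta> z)"
    using assms(1) by (rule holomorphic_polynomialE)
  obtain B' c' where q: "finite B'" "q = (\<lambda>z. \<Sum>\<beta>\<in>B'. c' \<beta> * monomial \<beta> z)"
    using assms(2) by (rule holomorphic_polynomialE)
  have "(\<lambda>z. \<Sum>x\<in>B \<times> B'. (c (fst x) * c' (snd x)) * monomial (\<lambda>i. fst x i + snd x i) z)
      \<in> holomorphic_polynomials"
    using p(1) q(1) by (intro holomorphic_polynomialI) simp
  moreover have "(\<Sum>x\<in>B \<times> B'. (c (fst x) * c' (snd x)) * monomial (\<lambda>i. fst x i + snd x i) z)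
      = p z * q z" for z
    unfolding p(2) q(2) sum_product sum.cartesian_product
    by (intro sum.cong) (auto simp: monomial_def power_add prod.distrib)
  ultimately show ?thesis by simp
qed

lemma polynomial_const: "(\<lambda>z. a) \<in> holomorphic_polynomials"
  using holomorphic_polynomialI[of "{()}" "\<lambda>_. a" "\<lambda>_ _. 0"] by (simp add: monomial_def)

lemma polynomial_coordinate: "(\<lambda>z. z $ i) \<in> holomorphic_polynomials"
proof -
  have "monomial (\<lambda>l. if l = i then 1 else 0) z = z $ i" for z
  proof -
    have "monomial (\<lambda>l. if l = i then 1 else 0) z = (\<Prod>l\<in>UNIV. if l = i then z $ l else 1)"
      unfolding monomial_def by (intro prod.cong) auto
    then show ?thesis by simp
  qed
  then show ?thesis
    using holomorphic_polynomialI[of "{()}" "\<lambda>_. 1" "\<lambda>_ l. if l = i then 1 else 0"] by simp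
qed

lemma polynomial_sum:
  assumes "\<And>i. i \<in> I \<Longrightarrow> p i \<in> holomorphic_polynomials"
  shows "(\<lambda>z. \<Sum>i\<in>I. p i z) \<in> holomorphic_polynomials"
  using assms
proof (induction I rule: infinite_finite_induct)
  case (insert i I)
  then show ?case using polynomial_lincomb[of "p i" "\<lambda>z. \<Sum>i\<in>I. p i z" 1] by simp
qed (simp_all add: polynomial_const)

lemma polynomial_prod:
  assumes "\<And>i. i \<in> I \<Longrightarrow> p i \<in> holomorphic_polynomials"
  shows "(\<lambda>z. \<Prod>i\<in>I. p i z) \<in> holomorphic_polynomials"
  using assms
proof (induction I rule: infinite_finite_induct)
  case (insert i I)
  then show ?case using polynomial_mult[of "p i" "\<lambda>z. \<Prod>i\<in>I. p i z"] by simp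
qed (simp_all add: polynomial_const)

lemma polynomial_power:
  assumes "p \<in> holomorphic_polynomials" shows "(\<lambda>z. p z ^ n) \<in> holomorphic_polynomials"
  using polynomial_prod[of "{..<n}" "\<lambda>_. p"] assms by simp

lemma polynomial_block_inner: "(\<lambda>\<zeta>. block_inner blk j \<zeta> w) \<in> holomorphic_polynomials"
  unfolding block_inner_def
  by (intro polynomial_sum polynomial_mult polynomial_coordinate polynomial_const)

section \<open>The closure of the polynomials\<close>

context finite_boundary_measure
begin

lemma polynomial_L2:
  assumes "p \<in> holomorphic_polynomials" shows "p \<in> L2_space \<sigma>"
proof -
  obtain B c where p: "finite B" "p = (\<lambda>z. \<Sum>\<beta>\<in>B. c \<beta> * monomial \<beta> z)"
    using assms by (rule holomorphic_polynomialE)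
  show ?thesis
  proof (rule bounded_mem_L2[OF finite_measure_axioms])
    show "p \<in> borel_measurable \<sigma>"
      unfolding p(2) by (intro measurable_continuous continuous_intros)
    show "norm (p \<zeta>) \<le> (\<Sum>\<beta>\<in>B. norm (c \<beta>))" if "\<zeta> \<in> space \<sigma>" for \<zeta>
      unfolding p(2) using norm_monomial_le[of _ blk] that
      by (intro order_trans[OF norm_sum] sum_mono) (simp add: norm_mult mult_left_le space_boundary)
  qed
qed

lemma H2_subset: "H2_space \<sigma> \<subseteq> L2_space \<sigma>"
  by (auto simp: H2_space_def)

lemma H2_closed:
  assumes "f \<in> L2_space \<sigma>" and "\<And>e. e > 0 \<Longrightarrow> \<exists>h\<in>H2_space \<sigma>. ip_dist (L2_inner \<sigma>) f h < e"
  shows "f \<in> H2_space \<sigma>"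
  unfolding H2_space_def
proof (intro CollectI conjI allI impI)
  fix e :: real assume "e > 0"
  then obtain h where h: "h \<in> H2_space \<sigma>" "ip_dist (L2_inner \<sigma>) f h < e/2"
    using assms(2)[of "e/2"] by auto
  then obtain p where p: "p \<in> holomorphic_polynomials" "ip_dist (L2_inner \<sigma>) h p < e/2"
    using \<open>e > 0\<close> unfolding H2_space_def by (auto dest: spec[of _ "e/2"])
  have "ip_dist (L2_inner \<sigma>) f p \<le> ip_dist (L2_inner \<sigma>) f h + ip_dist (L2_inner \<sigma>) h p"
    using assms(1) h(1) H2_subset polynomial_L2[OF p(1)] by (intro L2.ip_dist_triangle) auto
  then show "\<exists>p\<in>holomorphic_polynomials. ip_dist (L2_inner \<sigma>) f p < e"
    using p h by (intro bexI[of _ p]) auto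
qed (rule assms(1))

lemma polynomial_H2: "p \<in> holomorphic_polynomials \<Longrightarrow> p \<in> H2_space \<sigma>"
  unfolding H2_space_def using polynomial_L2 L2.ip_dist_self[of \<sigma> p] by force

lemma H2_subspace: "lin_subspace (H2_space \<sigma>)"
  unfolding lin_subspace_def
proof (intro conjI ballI allI)
  show "(\<lambda>x. 0) \<in> H2_space \<sigma>" by (intro polynomial_H2 polynomial_const)
next
  fix f g c assume f: "f \<in> H2_space \<sigma>" and g: "g \<in> H2_space \<sigma>"
  have fL: "f \<in> L2_space \<sigma>" and gL: "g \<in> L2_space \<sigma>" using f g H2_subset by auto
  show "(\<lambda>x. c * f x + g x) \<in> H2_space \<sigma>"
  proof (rule H2_closed)
    show "(\<lambda>x. c * f x + g x) \<in> L2_space \<sigma>" using fL gL by (rule L2_lincomb)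
    fix e :: real assume "e > 0"
    \<comment> \<open>The summand 1 avoids a division by zero when \<open>c = 0\<close>.\<close>
    then have e: "e / (2 * (norm c + 1)) > 0" "e / 2 > 0" by (simp_all add: add_nonneg_pos)
    obtain p where p: "p \<in> holomorphic_polynomials"
        "ip_dist (L2_inner \<sigma>) f p < e / (2 * (norm c + 1))"
      using f e(1) unfolding H2_space_def by blast
    obtain q where q: "q \<in> holomorphic_polynomials" "ip_dist (L2_inner \<sigma>) g q < e / 2"
      using g e(2) unfolding H2_space_def by blast
    have pL: "(\<lambda>x. f x - p x) \<in> L2_space \<sigma>" and qL: "(\<lambda>x. g x - q x) \<in> L2_space \<sigma>"
      by (intro L2.diff_mem fL gL polynomial_L2 p(1) q(1))+
    have "ip_dist (L2_inner \<sigma>) (\<lambda>x. c * f x + g x) (\<lambda>x. c * p x + q x)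
        = ip_norm (L2_inner \<sigma>) (\<lambda>x. c * (f x - p x) + (g x - q x))"
      by (simp add: ip_dist_def algebra_simps)
    also have "\<dots> \<le> ip_norm (L2_inner \<sigma>) (\<lambda>x. c * (f x - p x)) + ip_norm (L2_inner \<sigma>) (\<lambda>x. g x - q x)"
      by (intro L2.ip_norm_triangle L2.scale_mem pL qL)
    also have "ip_norm (L2_inner \<sigma>) (\<lambda>x. c * (f x - p x)) = norm c * ip_dist (L2_inner \<sigma>) f p"
      by (simp add: L2_norm norm_mult power_mult_distrib real_sqrt_mult ip_dist_def)
    also have "norm c * ip_dist (L2_inner \<sigma>) f p \<le> norm c * (e / (2 * (norm c + 1)))"
      using p(2) by (intro mult_left_mono) auto
    also have "norm c * (e / (2 * (norm c + 1))) \<le> e / 2"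
      using \<open>e > 0\<close> by (simp add: divide_simps add_nonneg_pos mult_left_mono)
    also have "ip_norm (L2_inner \<sigma>) (\<lambda>x. g x - q x) < e / 2"
      using q(2) by (simp add: ip_dist_def)
    finally have "ip_dist (L2_inner \<sigma>) (\<lambda>x. c * f x + g x) (\<lambda>x. c * p x + q x) < e"
      by simp
    then show "\<exists>h\<in>H2_space \<sigma>. ip_dist (L2_inner \<sigma>) (\<lambda>x. c * f x + g x) h < e"
      using polynomial_H2[OF polynomial_lincomb[OF p(1) q(1)]] by blast
  qed
qed

lemma H2_complete: "ip_complete (L2_inner \<sigma>) (H2_space \<sigma>)"
  unfolding ip_complete_def
proof (intro allI impI)
  fix F :: "nat \<Rightarrow> complex ^ 'n \<Rightarrow> complex"
  assume F: "\<forall>n. F n \<in> H2_space \<sigma>" "ip_cauchy (L2_inner \<sigma>) F"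
  have FL: "F n \<in> L2_space \<sigma>" for n using F(1) H2_subset by blast
  then obtain f where f: "f \<in> L2_space \<sigma>" "(\<lambda>n. ip_dist (L2_inner \<sigma>) (F n) f) \<longlonglongrightarrow> 0"
    using L2_complete[of \<sigma>, unfolded ip_complete_def, rule_format, of F] F(2) by blast
  have "f \<in> H2_space \<sigma>"
  proof (rule H2_closed[OF f(1)])
    fix e :: real assume "e > 0"
    then obtain n where "ip_dist (L2_inner \<sigma>) (F n) f < e"
      using order_tendstoD(2)[OF f(2)] by (auto simp: eventually_sequentially)
    then show "\<exists>h\<in>H2_space \<sigma>. ip_dist (L2_inner \<sigma>) f h < e"
      using F(1) L2.ip_dist_commute[OF FL f(1)] by (intro bexI[of _ "F n"]) auto
  qed
  with f(2) show "\<exists>f\<in>H2_space \<sigma>. (\<lambda>n. ip_dist (L2_inner \<sigma>) (F n) f) \<longlonglongrightarrow> 0" by blast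
qed

text \<open>This gives the totality of the Cauchy kernels: orthogonality passes from kernels to
  monomials by differentiation, to polynomials by linearity, and to their closure by
  Cauchy-Schwarz.\<close>

lemma H2_annihilator:
  assumes surj: "surj blk" and g: "g \<in> L2_space \<sigma>"
    and zero: "\<And>w. w \<in> ball_product blk \<Longrightarrow> L2_inner \<sigma> g (\<lambda>\<zeta>. cauchy_kernel blk \<zeta> w) = 0"
    and f: "f \<in> H2_space \<sigma>"
  shows "L2_inner \<sigma> g f = 0"
proof -
  have gi: "integrable \<sigma> g" by (rule L2_integrable[OF finite_measure_axioms g])
  have mono: "(\<integral>\<zeta>. g \<zeta> * cnj (monomial \<beta> \<zeta>) \<partial>\<sigma>) = 0" for \<beta>
    using zero by (intro annihilator_monomials[OF surj gi]) (simp add: L2_inner_def cnj_cauchy_kernel)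
  have poly: "L2_inner \<sigma> g p = 0" if p: "p \<in> holomorphic_polynomials" for p
  proof -
    obtain B c where p: "finite B" "p = (\<lambda>z. \<Sum>\<beta>\<in>B. c \<beta> * monomial \<beta> z)"
      using p by (rule holomorphic_polynomialE)
    have "L2_inner \<sigma> g p = (\<integral>\<zeta>. (\<Sum>\<beta>\<in>B. cnj (c \<beta>) * (g \<zeta> * cnj (monomial \<beta> \<zeta>))) \<partial>\<sigma>)"
      by (simp add: L2_inner_def p(2) sum_distrib_left mult_ac)
    also have "\<dots> = 0"
      using integrable_mult_cnj_monomial[OF gi] by (simp add: Bochner_Integration.integral_sum mono)
    finally show ?thesis .
  qed
  have fL: "f \<in> L2_space \<sigma>" using f H2_subset by blast
  have "norm (L2_inner \<sigma> g f) \<le> 0 + e" if "e > 0" for e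
  proof -
    have "e / (ip_norm (L2_inner \<sigma>) g + 1) > 0"
      using that L2.ip_norm_nonneg[OF g] by simp
    then obtain p where p: "p \<in> holomorphic_polynomials"
        "ip_dist (L2_inner \<sigma>) f p < e / (ip_norm (L2_inner \<sigma>) g + 1)"
      using f unfolding H2_space_def by blast
    have pL: "p \<in> L2_space \<sigma>" using p(1) by (rule polynomial_L2)
    have "L2_inner \<sigma> g f = L2_inner \<sigma> g (\<lambda>x. f x - p x)"
      using poly[OF p(1)] by (simp add: L2.ip_diff_right fL pL g)
    then have "norm (L2_inner \<sigma> g f) \<le> ip_norm (L2_inner \<sigma>) g * ip_dist (L2_inner \<sigma>) f p"
      using L2.cauchy_schwarz[OF g L2.diff_mem[OF fL pL]] by (simp add: ip_dist_def)
    also have "\<dots> \<le> (ip_norm (L2_inner \<sigma>) g + 1) * (e / (ip_norm (L2_inner \<sigma>) g + 1))"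
      using p(2) L2.ip_norm_nonneg[OF g] L2.ip_dist_nonneg[OF fL pL] that
      by (intro mult_mono) auto
    also have "\<dots> = e" using L2.ip_norm_nonneg[OF g] by simp
    finally show ?thesis by simp
  qed
  then have "norm (L2_inner \<sigma> g f) \<le> 0" by (rule field_le_epsilon)
  then show ?thesis by simp
qed

text \<open>The geometric series of each factor is truncated. The resulting polynomials converge
  pointwise and obey the same bound \<open>C\<close> as the kernel, so dominated convergence over
  the finite measure gives convergence in \<open>L\<^sup>2\<close>.\<close>

lemma cauchy_kernel_H2:
  assumes w: "w \<in> ball_product blk"
  shows "(\<lambda>\<zeta>. cauchy_kernel blk \<zeta> w) \<in> H2_space \<sigma>"
proof -
  let ?n = "\<lambda>j. card (blk -` {j})"
  define p where "p N \<zeta> = (\<Prod>j\<in>UNIV. (\<Sum>m<N. block_inner blk j \<zeta> w ^ m) ^ ?n j)" for N \<zeta>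
  define C where "C = power_kernel_bound blk ?n w"
  have poly: "p N \<in> holomorphic_polynomials" for N
    unfolding p_def
    by (intro polynomial_prod polynomial_power polynomial_sum polynomial_block_inner)
  have w1: "block_norm blk j w < 1" for j using w by (simp add: ball_product_def)
  have inner: "norm (block_inner blk j \<zeta> w) \<le> block_norm blk j w" if "\<zeta> \<in> space \<sigma>" for j \<zeta>
    using norm_block_inner_le[of blk j \<zeta> w] that by (simp add: space_boundary dist_boundary_def)
  have bound_p: "norm (p N \<zeta>) \<le> C" if \<zeta>: "\<zeta> \<in> space \<sigma>" for N \<zeta>
  proof -
    have "norm (\<Sum>m<N. block_inner blk j \<zeta> w ^ m) \<le> 1 / (1 - block_norm blk j w)" for j
    proof -
      have "norm (\<Sum>m<N. block_inner blk j \<zeta> w ^ m) \<le> (\<Sum>m<N. block_norm blk j w ^ m)"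
        using inner[OF \<zeta>] by (intro order_trans[OF norm_sum] sum_mono) (simp add: norm_power power_mono)
      also have "\<dots> \<le> (\<Sum>m. block_norm blk j w ^ m)"
        using w1[of j] block_norm_nonneg[of blk j w] by (intro sum_le_suminf summable_geometric) auto
      also have "\<dots> = 1 / (1 - block_norm blk j w)"
        using w1 block_norm_nonneg[of blk j w] by (intro suminf_geometric) auto
      finally show ?thesis .
    qed
    then show ?thesis
      unfolding p_def C_def power_kernel_bound_def prod_norm[symmetric]
      by (intro prod_mono) (simp add: norm_power power_mono flip: power_one_over)
  qed
  have bound_c: "norm (cauchy_kernel blk \<zeta> w) \<le> C" if "\<zeta> \<in> space \<sigma>" for \<zeta>
    using norm_power_kernel_le[OF w, of \<zeta>] that
    unfolding norm_cauchy_kernel_commute[of blk \<zeta>] by (simp add: space_boundary cauchy_kernel_eq C_def)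
  have lim: "(\<lambda>N. p N \<zeta>) \<longlonglongrightarrow> cauchy_kernel blk \<zeta> w" if \<zeta>: "\<zeta> \<in> space \<sigma>" for \<zeta>
  proof -
    have "(\<lambda>N. \<Sum>m<N. block_inner blk j \<zeta> w ^ m) \<longlonglongrightarrow> 1 / (1 - block_inner blk j \<zeta> w)" for j
      using geometric_sums[of "block_inner blk j \<zeta> w"] inner[OF \<zeta>, of j] w1[of j]
      by (simp add: sums_def)
    then have "(\<lambda>N. p N \<zeta>) \<longlonglongrightarrow> (\<Prod>j\<in>UNIV. (1 / (1 - block_inner blk j \<zeta> w)) ^ ?n j)"
      unfolding p_def by (intro tendsto_intros)
    then show ?thesis by (simp add: cauchy_kernel_def power_one_over)
  qed
  have cL: "(\<lambda>\<zeta>. cauchy_kernel blk \<zeta> w) \<in> L2_space \<sigma>" by (rule cauchy_kernel_L2[OF w])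
  have [measurable]: "(\<lambda>\<zeta>. cauchy_kernel blk \<zeta> w) \<in> borel_measurable \<sigma>" "p N \<in> borel_measurable \<sigma>" for N
    using cL polynomial_L2[OF poly] by (auto intro: L2_measurable)
  have "(\<lambda>N. \<integral>\<zeta>. (norm (cauchy_kernel blk \<zeta> w - p N \<zeta>))\<^sup>2 \<partial>\<sigma>) \<longlonglongrightarrow> (\<integral>\<zeta>. 0 \<partial>\<sigma>)"
  proof (rule integral_dominated_convergence)
    show "AE \<zeta> in \<sigma>. (\<lambda>N. (norm (cauchy_kernel blk \<zeta> w - p N \<zeta>))\<^sup>2) \<longlonglongrightarrow> 0"
    proof (rule AE_I2)
      fix \<zeta> assume "\<zeta> \<in> space \<sigma>"
      from tendsto_power[OF tendsto_norm[OF tendsto_diff[OF tendsto_const lim[OF this]]]]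
      have "(\<lambda>N. (norm (cauchy_kernel blk \<zeta> w - p N \<zeta>))\<^sup>2) \<longlonglongrightarrow>
          (norm (cauchy_kernel blk \<zeta> w - cauchy_kernel blk \<zeta> w))\<^sup>2" .
      then show "(\<lambda>N. (norm (cauchy_kernel blk \<zeta> w - p N \<zeta>))\<^sup>2) \<longlonglongrightarrow> 0" by simp
    qed
    show "AE \<zeta> in \<sigma>. norm ((norm (cauchy_kernel blk \<zeta> w - p N \<zeta>))\<^sup>2) \<le> (C + C)\<^sup>2" for N
    proof (rule AE_I2)
      fix \<zeta> assume \<zeta>: "\<zeta> \<in> space \<sigma>"
      have "norm (cauchy_kernel blk \<zeta> w - p N \<zeta>) \<le> C + C"
        using bound_c[OF \<zeta>] bound_p[OF \<zeta>, of N] by (intro order_trans[OF norm_triangle_ineq4]) auto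
      from power_mono[OF this norm_ge_zero, of 2]
      show "norm ((norm (cauchy_kernel blk \<zeta> w - p N \<zeta>))\<^sup>2) \<le> (C + C)\<^sup>2"
        by simp
    qed
  qed auto
  then have "(\<lambda>N. sqrt (\<integral>\<zeta>. (norm (cauchy_kernel blk \<zeta> w - p N \<zeta>))\<^sup>2 \<partial>\<sigma>)) \<longlonglongrightarrow> sqrt 0"
    by (intro tendsto_real_sqrt) simp
  then have l: "(\<lambda>N. ip_dist (L2_inner \<sigma>) (\<lambda>\<zeta>. cauchy_kernel blk \<zeta> w) (p N)) \<longlonglongrightarrow> 0"
    by (simp add: ip_dist_def L2_norm)
  show ?thesis
  proof (rule H2_closed[OF cL])
    fix e :: real assume "e > 0"
    then obtain N where "ip_dist (L2_inner \<sigma>) (\<lambda>\<zeta>. cauchy_kernel blk \<zeta> w) (p N) < e"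
      using order_tendstoD(2)[OF l] by (auto simp: eventually_sequentially)
    then show "\<exists>h\<in>H2_space \<sigma>. ip_dist (L2_inner \<sigma>) (\<lambda>\<zeta>. cauchy_kernel blk \<zeta> w) h < e"
      using polynomial_H2[OF poly] by blast
  qed
qed

end

section \<open>The Clark operators\<close>

text \<open>The Clark unitary is determined only up to distance 0, so the adjoint relation is
  claimed for every operator with its defining properties; the separate existence claim keeps this
  from being vacuous.\<close>

theorem theorem3p2:
  fixes blk :: "'n::finite \<Rightarrow> 'k::finite"
    and b :: "complex ^ 'n \<Rightarrow> complex"
    and \<alpha> :: complex
    and \<sigma> :: "(complex ^ 'n) measure"
    and H :: "(complex ^ 'n \<Rightarrow> complex) set"
    and ip :: "(complex ^ 'n) semi_inner"
  assumes "surj blk"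
    and "holomorphic_sv b (ball_product blk)"
    and "b ` ball_product blk \<subseteq> ball 0 1"
    and "\<not> b constant_on ball_product blk"
    and "\<alpha> \<in> sphere 0 1"
    and "clark_measure blk b \<alpha> \<sigma>"
    and "de_branges_rovnyak blk b H ip"
  shows "partial_isometry (L2_space \<sigma>) (L2_inner \<sigma>) H ip (V_op blk b \<alpha> \<sigma>) \<and>
    (\<exists>U. is_clark_unitary blk b \<alpha> \<sigma> H ip U) \<and>
    (\<forall>U. is_clark_unitary blk b \<alpha> \<sigma> H ip U \<longrightarrow>
       is_adjoint H ip (H2_space \<sigma>) (L2_inner \<sigma>) U (V_op blk b \<alpha> \<sigma>)) \<and>
    (\<forall>z\<in>ball_product blk. \<forall>w\<in>ball_product blk.
       V_op blk b \<alpha> \<sigma> (\<lambda>\<zeta>. cauchy_kernel blk \<zeta> w) z =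
       inverse (1 - \<alpha> * cnj (b w)) * dbr_kernel blk b z w)"
proof -
  let ?D = "ball_product blk"
  interpret finite_measure \<sigma> using assms(6) by (simp add: clark_measure_def)
  interpret finite_boundary_measure \<sigma> blk
    using assms(6) by unfold_locales (simp add: clark_measure_def)
  interpret R: reproducing_kernel_space ?D H ip "dbr_kernel blk b"
    using assms(7) by (simp add: de_branges_rovnyak_def)
  have \<alpha>: "norm \<alpha> = 1" using assms(5) by simp
  have ne: "1 - \<alpha> * cnj (b w) \<noteq> 0" if "w \<in> ?D" for w
  proof -
    have "norm (b w) < 1" using assms(3) that by auto
    then have "norm (\<alpha> * cnj (b w)) < 1" using \<alpha> by (simp add: norm_mult)
    then show ?thesis by auto
  qed
  define e where "e w = (\<lambda>\<zeta>. (1 - \<alpha> * cnj (b w)) * cauchy_kernel blk \<zeta> w)" for w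
  have cL: "(\<lambda>\<zeta>. cauchy_kernel blk \<zeta> w) \<in> L2_space \<sigma>" if "w \<in> ?D" for w
    using that by (rule cauchy_kernel_L2)
  \<comment> \<open>Conjugating \<open>e z\<close> produces precisely the factor and the integrand
    of \<open>V_op\<close>, so the abstract \<open>F.V\<close> and \<open>V_op\<close> are the same
    function.\<close>
  have inner_e: "L2_inner \<sigma> g (e z) = (1 - cnj \<alpha> * b z) * (\<integral>\<zeta>. cauchy_kernel blk z \<zeta> * g \<zeta> \<partial>\<sigma>)"
    for g z
    by (simp add: L2_inner_def e_def cnj_cauchy_kernel mult_ac flip: integral_mult_right_zero)
  interpret F: feature_map ?D H ip "dbr_kernel blk b" "L2_space \<sigma>" "L2_inner \<sigma>" e "H2_space \<sigma>"
  proof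
    show "ip_complete (L2_inner \<sigma>) (L2_space \<sigma>)" by (rule L2_complete)
    show "lin_subspace (H2_space \<sigma>)" by (rule H2_subspace)
    show "H2_space \<sigma> \<subseteq> L2_space \<sigma>" by (rule H2_subset)
    show "ip_complete (L2_inner \<sigma>) (H2_space \<sigma>)" by (rule H2_complete)
    show "e w \<in> H2_space \<sigma>" if "w \<in> ?D" for w
      unfolding e_def using that by (intro lin_subspace_scale H2_subspace cauchy_kernel_H2)
    show "L2_inner \<sigma> (e w) (e z) = dbr_kernel blk b z w" if w: "w \<in> ?D" and z: "z \<in> ?D" for w z
    proof -
      have "L2_inner \<sigma> (e w) (e z) = (1 - cnj \<alpha> * b z) * (1 - \<alpha> * cnj (b w)) *
          (\<integral>\<zeta>. cauchy_kernel blk z \<zeta> * cauchy_kernel blk \<zeta> w \<partial>\<sigma>)"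
        unfolding inner_e by (simp add: e_def mult.left_commute[of _ "1 - \<alpha> * cnj (b w)"])
      also have "\<dots> = dbr_kernel blk b z w"
        by (rule clark_identity[OF assms(6) \<alpha> assms(2,3) z w])
      finally show ?thesis .
    qed
    show "L2_inner \<sigma> g m = 0"
      if g: "g \<in> L2_space \<sigma>" and orth: "\<And>w. w \<in> ?D \<Longrightarrow> L2_inner \<sigma> g (e w) = 0" and m: "m \<in> H2_space \<sigma>"
      for g m
    proof (rule H2_annihilator[OF assms(1) g _ m])
      fix w assume w: "w \<in> ?D"
      have "cnj (1 - \<alpha> * cnj (b w)) * L2_inner \<sigma> g (\<lambda>\<zeta>. cauchy_kernel blk \<zeta> w) = 0"
        using orth[OF w] unfolding e_def by (subst (asm) L2.ip_scale_right[OF cL[OF w] g])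
      then show "L2_inner \<sigma> g (\<lambda>\<zeta>. cauchy_kernel blk \<zeta> w) = 0"
        using ne[OF w] by (metis complex_cnj_zero_iff mult_eq_0_iff)
    qed
  qed
  have V: "V_op blk b \<alpha> \<sigma> = F.V"
    unfolding V_op_def F.V_def cauchy_transform_def inner_e ..
  \<comment> \<open>The Clark unitary is specified by values almost everywhere, the abstract theory
    by distance 0; this translates between the two.\<close>
  have e_AE: "ip_dist (L2_inner \<sigma>) f (e w) = 0 \<longleftrightarrow>
      (AE \<zeta> in \<sigma>. f \<zeta> = (1 - \<alpha> * cnj (b w)) * cauchy_kernel blk \<zeta> w)"
    if "f \<in> L2_space \<sigma>" "w \<in> ?D" for f w
    using L2_dist_zero_AE[OF that(1) F.e_mem[OF that(2)]] L2_AE_dist_zero[where M = \<sigma> and f = f and g = "e w"]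
    by (auto simp: e_def)
  have "is_clark_unitary blk b \<alpha> \<sigma> H ip F.U"
    unfolding is_clark_unitary_def
    using F.unitary_U F.dist_U_kernel e_AE F.U_mem R.kernel_mem H2_subset by blast
  moreover have "is_adjoint H ip (H2_space \<sigma>) (L2_inner \<sigma>) U F.V"
    if U: "is_clark_unitary blk b \<alpha> \<sigma> H ip U" for U
  proof (rule F.adjoint_V)
    show un: "unitary_map H ip (H2_space \<sigma>) (L2_inner \<sigma>) U"
      using U by (simp add: is_clark_unitary_def)
    fix w assume w: "w \<in> ?D"
    have "U (F.k w) \<in> L2_space \<sigma>"
      using un R.kernel_mem[OF w] H2_subset unfolding unitary_map_def linear_map_def by blast
    then show "ip_dist (L2_inner \<sigma>) (U (F.k w)) (e w) = 0"
      using U w by (simp add: e_AE is_clark_unitary_def)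
  qed
  moreover have "F.V (\<lambda>\<zeta>. cauchy_kernel blk \<zeta> w) z = inverse (1 - \<alpha> * cnj (b w)) * dbr_kernel blk b z w"
    if z: "z \<in> ?D" and w: "w \<in> ?D" for z w
  proof -
    have "(1 - \<alpha> * cnj (b w)) * F.V (\<lambda>\<zeta>. cauchy_kernel blk \<zeta> w) z = dbr_kernel blk b z w"
      using clark_identity[OF assms(6) \<alpha> assms(2,3) z w] z
      by (simp add: F.V_def on_set_def inner_e mult_ac)
    then show ?thesis using ne[OF w] by (simp add: field_simps)
  qed
  ultimately show ?thesis
    unfolding V using F.partial_isometry_V by blast
qed

end
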